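(* Let $M$ be a (not necessarily finitely generated) $\mathbb{Z}[\mathbb{Z}_2]$-module which is free as a $\mathbb{Z}$-module. Then $M$ is a direct sum $\bigoplus_{i \in I} M_i$ of $\mathbb{Z}[\mathbb{Z}_2]$-submodules in which each $M_i$ is isomorphic, as a $\mathbb{Z}[\mathbb{Z}_2]$-module, to one of the three modules $T_1$, $T_2$, or $T_3$, where $T_1 = \mathbb{Z}$ with the nontrivial element of $\mathbb{Z}_2$ acting trivially, $T_2 = \mathbb{Z}$ with the nontrivial element of $\mathbb{Z}_2$ acting by multiplication by $-1$, and $T_3 = \mathbb{Z}[\mathbb{Z}_2]$. The multiplicities of $T_1$, $T_2$ and $T_3$ in such a direct sum decomposition are independent of the decomposition.
   Context: $\mathbb{Z}_2 = \mathbb{Z}/2\mathbb{Z}$, and $\mathbb{Z}[\mathbb{Z}_2]$ is its integral group ring. The multiplicity of $T_j$ in a decomposition $\bigoplus_{i \in I} M_i$ is the cardinality of the set of $i \in I$ with $M_i \cong T_j$. *)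

theory Defs
  imports
    Complex_Main
    "HOL-Library.Poly_Mapping"
    "HOL-Library.Numeral_Type"
    "HOL-Library.Equipollence"
begin

abbreviation lookup :: "('a \<Rightarrow>\<^sub>0 'b::zero) \<Rightarrow> 'a \<Rightarrow> 'b"
  where "lookup \<equiv> Poly_Mapping.lookup"

abbreviation keys :: "('a \<Rightarrow>\<^sub>0 'b::zero) \<Rightarrow> 'a set"
  where "keys \<equiv> Poly_Mapping.keys"

text \<open>
  The product on \<^typ>\<open>'a \<Rightarrow>\<^sub>0 'b\<close> is convolution over the additive monoid \<^typ>\<open>'a\<close>, and
  \<^typ>\<open>2\<close> is the type of integers modulo 2. Hence \<^typ>\<open>2 \<Rightarrow>\<^sub>0 int\<close> is the integral group ring
  of the group of order 2; the additive group is written multiplicatively in the ring, so that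
  \<open>single 0 1\<close> is the unit and \<open>single 1 1\<close> is the nontrivial group element.
\<close>

type_synonym group_ring_Z2 = "2 \<Rightarrow>\<^sub>0 int"

definition sigma :: group_ring_Z2
  where "sigma = Poly_Mapping.single 1 1"


text \<open>
  The ring element with coefficients \<open>lookup r 0\<close> and \<open>lookup r 1\<close> acts through the integers
  and the nontrivial group element, see \<open>group_ring_Z2_eq\<close>, \<open>T1_sigma\<close> and \<open>T2_sigma\<close> below.
\<close>

definition T1 :: "group_ring_Z2 \<Rightarrow> int \<Rightarrow> int"
  where "T1 r n = lookup r 0 * n + lookup r 1 * n"

definition T2 :: "group_ring_Z2 \<Rightarrow> int \<Rightarrow> int"
  where "T2 r n = lookup r 0 * n + lookup r 1 * (- n)"

definition T3 :: "group_ring_Z2 \<Rightarrow> group_ring_Z2 \<Rightarrow> group_ring_Z2"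
  where "T3 r x = r * x"

lemma UNIV_2: "(UNIV :: 2 set) = {0, 1}"
  by (rule sym, rule card_subset_eq) auto

lemma two_eq_0: "(1 :: 2) + 1 = 0"
proof -
  have "(1 :: 2) + 1 = 0 \<or> (1 :: 2) + 1 = 1" using UNIV_2 by blast
  then show ?thesis by (metis add_cancel_right_right zero_neq_one)
qed

lemma group_ring_Z2_eq: "r = of_int (lookup r 0) + of_int (lookup r 1) * sigma"
  for r :: group_ring_Z2
proof (rule poly_mapping_eqI)
  fix k :: 2
  have "k = 0 \<or> k = 1" using UNIV_2 by blast
  then show "lookup r k = lookup (of_int (lookup r 0) + of_int (lookup r 1) * sigma) k"
    by (auto simp: sigma_def lookup_add mult_single lookup_single when_def
        simp flip: single_of_int)
qed

lemma sigma_sigma: "sigma * sigma = 1"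
  by (simp add: sigma_def mult_single two_eq_0 del: one_add_one)

lemma lookup_mult_Z2:
  fixes r s :: group_ring_Z2
  shows "lookup (r * s) 0 = lookup r 0 * lookup s 0 + lookup r 1 * lookup s 1"
    and "lookup (r * s) 1 = lookup r 0 * lookup s 1 + lookup r 1 * lookup s 0"
proof -
  define a b c d where "a = lookup r 0" "b = lookup r 1" "c = lookup s 0" "d = lookup s 1"
  have "r * s = (of_int a + of_int b * sigma) * (of_int c + of_int d * sigma)"
    using group_ring_Z2_eq[of r] group_ring_Z2_eq[of s] by (simp add: a_b_c_d_def)
  also have "\<dots> = of_int (a * c) + of_int (a * d) * sigma + of_int (b * c) * sigma
      + of_int (b * d) * (sigma * sigma)"
    by (simp add: algebra_simps)
  also have "\<dots> = of_int (a * c + b * d) + of_int (a * d + b * c) * sigma"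
    unfolding sigma_sigma by (simp add: algebra_simps)
  finally have eq: "r * s = of_int (a * c + b * d) + of_int (a * d + b * c) * sigma" .
  show "lookup (r * s) 0 = lookup r 0 * lookup s 0 + lookup r 1 * lookup s 1"
    and "lookup (r * s) 1 = lookup r 0 * lookup s 1 + lookup r 1 * lookup s 0"
    unfolding eq a_b_c_d_def
    by (auto simp: sigma_def lookup_add mult_single lookup_single when_def
        simp flip: single_of_int simp del: of_int_add of_int_mult)
qed

lemma module_T1: "module T1"
  by unfold_locales (auto simp: T1_def lookup_add lookup_mult_Z2 lookup_one when_def algebra_simps)

lemma module_T2: "module T2"
  by unfold_locales (auto simp: T2_def lookup_add lookup_mult_Z2 lookup_one when_def algebra_simps)

lemma module_T3: "module T3"
  by unfold_locales (auto simp: T3_def algebra_simps)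

lemma T1_sigma: "T1 sigma n = n"
  by (simp add: T1_def sigma_def lookup_single when_def)

lemma T2_sigma: "T2 sigma n = - n"
  by (simp add: T2_def sigma_def lookup_single when_def)


definition restrict_to_int :: "('r::comm_ring_1 \<Rightarrow> 'm::ab_group_add \<Rightarrow> 'm) \<Rightarrow> int \<Rightarrow> 'm \<Rightarrow> 'm"
  where "restrict_to_int scale n x = scale (of_int n) x"

lemma module_restrict_to_int: "module scale \<Longrightarrow> module (restrict_to_int scale)"
  unfolding module_def restrict_to_int_def by simp

definition free_module :: "('r::comm_ring_1 \<Rightarrow> 'm::ab_group_add \<Rightarrow> 'm) \<Rightarrow> bool"
  where "free_module scale \<longleftrightarrow>
    (\<exists>B. \<not> module.dependent scale B \<and> module.span scale B = UNIV)"

text \<open>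
  Internal direct sums: the finitely supported families \<open>f\<close> with \<open>f i \<in> N i\<close> for \<open>i \<in> I\<close> and
  support in \<open>I\<close> are the elements of the external direct sum, and the condition says that the
  summation map from the external direct sum to the whole module is bijective.
\<close>

definition direct_sum_decomposition ::
    "('r::comm_ring_1 \<Rightarrow> 'm::ab_group_add \<Rightarrow> 'm) \<Rightarrow> 'i set \<Rightarrow> ('i \<Rightarrow> 'm set) \<Rightarrow> bool"
  where "direct_sum_decomposition scale I N \<longleftrightarrow>
    (\<forall>i\<in>I. module.subspace scale (N i)) \<and>
    (\<forall>x. \<exists>!f :: 'i \<Rightarrow>\<^sub>0 'm.
      keys f \<subseteq> I \<and> (\<forall>i\<in>I. lookup f i \<in> N i) \<and> x = (\<Sum>i\<in>keys f. lookup f i))"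

text \<open>
  For a submodule \<open>N\<close> of the module given by \<open>scale\<close>, this says that \<open>N\<close> is isomorphic to the
  module given by \<open>scaleT\<close>.
\<close>

definition submodule_iso ::
    "('r::comm_ring_1 \<Rightarrow> 'm::ab_group_add \<Rightarrow> 'm) \<Rightarrow> 'm set \<Rightarrow>
     ('r \<Rightarrow> 't::ab_group_add \<Rightarrow> 't) \<Rightarrow> bool"
  where "submodule_iso scale N scaleT \<longleftrightarrow>
    (\<exists>f. module_hom scaleT scale f \<and> bij_betw f UNIV N)"

definition T_decomposition ::
    "(group_ring_Z2 \<Rightarrow> 'm::ab_group_add \<Rightarrow> 'm) \<Rightarrow> 'i set \<Rightarrow> ('i \<Rightarrow> 'm set) \<Rightarrow> bool"
  where "T_decomposition scale I N \<longleftrightarrow>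
    direct_sum_decomposition scale I N \<and>
    (\<forall>i\<in>I. submodule_iso scale (N i) T1 \<or> submodule_iso scale (N i) T2 \<or>
            submodule_iso scale (N i) T3)"

text \<open>
  The multiplicity of \<open>scaleT\<close> in a decomposition is the cardinality, possibly infinite, of the
  following set; multiplicities are compared by \<^const>\<open>eqpoll\<close>.
\<close>

definition summands_iso ::
    "('r::comm_ring_1 \<Rightarrow> 'm::ab_group_add \<Rightarrow> 'm) \<Rightarrow> 'i set \<Rightarrow> ('i \<Rightarrow> 'm set) \<Rightarrow>
     ('r \<Rightarrow> 't::ab_group_add \<Rightarrow> 't) \<Rightarrow> 'i set"
  where "summands_iso scale I N scaleT = {i \<in> I. submodule_iso scale (N i) scaleT}"

end

theory Submission
  imports Defs "HOL-Algebra.Free_Abelian_Groups"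
begin

text \<open>
  Write \<open>s\<close> for the action of the nontrivial element, so that \<open>s\<close> is an additive involution of
  the free abelian group \<open>M\<close>. The endomorphisms \<open>1 + s\<close> and \<open>1 - s\<close> annihilate each other, and
  together they embed \<open>M\<close> into \<open>P \<times> D\<close>, where \<open>P = (1 + s) M\<close> and \<open>D = (1 - s) M\<close>,
  because \<open>2 z = (1 + s) z + (1 - s) z\<close> and \<open>M\<close> is torsion free.

  Existence. Well-order a basis of \<open>M\<close>; every nonzero element then has a leading basis vector,
  and choosing for each leading basis vector that occurs in a subgroup an element with the
  smallest positive leading coefficient gives a basis of this subgroup. Choose such elements of
  \<open>P\<close> in the form \<open>(1 + s) z\<close>, where \<open>z\<close> is taken with \<open>(1 - s) z\<close> as low as possible. Two
  things can happen at a leading basis vector \<open>b\<close> of \<open>P\<close>. If \<open>(1 - s) z = 0\<close> is possible, then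
  \<open>z\<close> spans a copy of \<open>T1\<close>. If not, then \<open>(1 - s) z\<close> has a lowest possible leading basis vector
  \<open>c\<close>. For \<open>w\<close> in \<open>M\<close>, subtracting \<open>t (1 - s) w\<close> from \<open>z\<close> leaves \<open>(1 + s) z\<close> unchanged and
  subtracts \<open>2 t (1 - s) w\<close> from \<open>(1 - s) z\<close>; by minimality the leading coefficient is an odd
  multiple of the smallest one, and can be made equal to it. Thus \<open>z\<close> serves \<open>P\<close> at \<open>b\<close> and \<open>D\<close>
  at \<open>c\<close> simultaneously, and this matching of some leading basis vectors of \<open>P\<close> with some of \<open>D\<close>
  is symmetric in \<open>s\<close> and \<open>- s\<close> (\<open>fixed_or_linked\<close>). The matched \<open>z\<close> generate copies of \<open>T3\<close>,
  and the unmatched leading basis vectors of \<open>D\<close> give copies of \<open>T2\<close>. Descent along the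
  well-order shows that these submodules span \<open>M\<close> (\<open>generators_span\<close>), and comparing leading
  basis vectors after applying \<open>1 + s\<close> and \<open>1 - s\<close> shows that their sum is direct
  (\<open>generators_independent\<close>). The argument is the same for finite and infinite rank. It
  resembles the Bruhat decomposition: two bases of the vector space
  \<open>M / (ker (1 - s) + ker (1 + s))\<close> over the field with two elements, one coming from \<open>P\<close> and
  one from \<open>D\<close>, are replaced by a common basis that is triangular with respect to both of them,
  and triangular changes of basis lift to the integers.

  Uniqueness. The multiplicities of \<open>T1\<close>, \<open>T2\<close> and \<open>T3\<close> are the dimensions over the field with
  two elements of \<open>ker (1 - s) / (1 + s) M\<close>, of \<open>ker (1 + s) / (1 - s) M\<close> and of
  \<open>M / (ker (1 - s) + ker (1 + s))\<close>. These quotients are compatible with direct sums, so it is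
  enough to compute them for the three modules (\<open>direct_sum_mod_2_basis\<close>). That two bases are
  equipollent follows by counting vectors (\<open>mod_2_basis_eqpoll\<close>): a vector of a space with basis
  \<open>I\<close> over this field is a finite subset of \<open>I\<close>.
\<close>

section \<open>Leading terms in a free abelian group\<close>

text \<open>
  The coordinates with respect to a well-ordered basis embed a free abelian group into a direct
  sum of copies of the integers. Leading terms only involve this embedding, and so the axioms
  speak of coordinates, not of a basis.
\<close>

locale ordered_coordinates = module smul
  for smul :: "int \<Rightarrow> 'm::ab_group_add \<Rightarrow> 'm" (infixr \<open>*z\<close> 75) +
  fixes coeff :: "'m \<Rightarrow> 'b \<Rightarrow> int"
    and less :: "'b \<Rightarrow> 'b \<Rightarrow> bool" (infix \<open>\<lless>\<close> 50)
  assumes coeff_add: "coeff (x + y) b = coeff x b + coeff y b"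
    and coeff_smul: "coeff (k *z x) b = k * coeff x b"
    and finite_coeff: "finite {b. coeff x b \<noteq> 0}"
    and eq_0_if_coeff: "(\<And>b. coeff x b = 0) \<Longrightarrow> x = 0"
    and wfp_less: "wfp (\<lless>)"
    and trans_less: "b \<lless> c \<Longrightarrow> c \<lless> d \<Longrightarrow> b \<lless> d"
    and total_less: "b \<lless> c \<or> b = c \<or> c \<lless> b"
begin

lemma coeff_0: "coeff 0 b = 0"
  using coeff_smul[of 0 0 b] by simp

lemma coeff_uminus: "coeff (- x) b = - coeff x b"
  using coeff_add[of x "- x" b] by (simp add: coeff_0)

lemma coeff_diff: "coeff (x - y) b = coeff x b - coeff y b"
  using coeff_add[of x "- y" b] by (simp add: coeff_uminus)

lemma less_irrefl: "\<not> b \<lless> b"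
  using wfp_less by (rule wfp_induct_rule) blast

lemma smul_eq_0_iff: "k *z x = 0 \<longleftrightarrow> k = 0 \<or> x = 0"
proof
  assume "k *z x = 0"
  then have "k * coeff x b = 0" for b
    by (metis coeff_smul coeff_0)
  then show "k = 0 \<or> x = 0"
    using eq_0_if_coeff[of x] by auto
qed auto

definition below :: "'b \<Rightarrow> 'm \<Rightarrow> bool"
  where "below b x \<longleftrightarrow> (\<forall>c. coeff x c \<noteq> 0 \<longrightarrow> c \<lless> b)"

definition leads :: "'b \<Rightarrow> 'm \<Rightarrow> bool"
  where "leads b x \<longleftrightarrow> coeff x b \<noteq> 0 \<and> (\<forall>c. coeff x c \<noteq> 0 \<longrightarrow> c = b \<or> c \<lless> b)"

lemma finite_has_greatest:
  assumes "finite A" "A \<noteq> {}"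
  shows "\<exists>b\<in>A. \<forall>c\<in>A. c = b \<or> c \<lless> b"
  using assms
proof (induction A rule: finite_ne_induct)
  case (insert a A)
  then obtain b where b: "b \<in> A" "\<forall>c\<in>A. c = b \<or> c \<lless> b"
    by blast
  consider "a \<lless> b" | "a = b" | "b \<lless> a"
    using total_less by blast
  then show ?case
  proof cases
    case 3
    then have "\<forall>c\<in>A. c \<lless> a"
      using b trans_less[OF _ 3] 3 by auto
    then show ?thesis
      by blast
  qed (use b in auto)
qed auto

lemma leads_exists:
  assumes "x \<noteq> 0"
  shows "\<exists>b. leads b x"
proof -
  have "{b. coeff x b \<noteq> 0} \<noteq> {}"
    using assms eq_0_if_coeff by blast
  from finite_has_greatest[OF finite_coeff this] show ?thesis
    unfolding leads_def by blast
qed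

lemma leads_unique: "leads b x \<Longrightarrow> leads c x \<Longrightarrow> b = c"
  using trans_less[of b c b] less_irrefl[of b] by (auto simp: leads_def)

lemma leads_nonzero: "leads b x \<Longrightarrow> x \<noteq> 0"
  by (auto simp: leads_def coeff_0)

lemma below_0: "below b 0"
  by (simp add: below_def coeff_0)

lemma below_imp_leads_less: "below b x \<Longrightarrow> leads c x \<Longrightarrow> c \<lless> b"
  by (simp add: below_def leads_def)

lemma below_diff_smul:
  assumes "leads b x" "leads b y" "coeff x b = k * coeff y b"
  shows "below b (x - k *z y)"
  unfolding below_def
proof (intro allI impI)
  fix c
  assume c: "coeff (x - k *z y) c \<noteq> 0"
  then have "coeff x c \<noteq> 0 \<or> coeff y c \<noteq> 0"
    by (auto simp: coeff_diff coeff_smul)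
  moreover have "c \<noteq> b"
    using c assms(3) by (auto simp: coeff_diff coeff_smul)
  ultimately show "c \<lless> b"
    using assms(1,2) by (auto simp: leads_def)
qed

lemma leads_smul_iff: "leads b (k *z x) \<longleftrightarrow> k \<noteq> 0 \<and> leads b x"
  by (auto simp: leads_def coeff_smul)

lemma leads_imp_below: "leads b x \<Longrightarrow> b \<lless> c \<Longrightarrow> below c x"
  using trans_less[of _ b c] by (auto simp: leads_def below_def)

lemma leads_diff:
  assumes "leads b x" "leads b y \<or> below b y" "coeff x b \<noteq> coeff y b"
  shows "leads b (x - y)"
  unfolding leads_def
proof (intro conjI allI impI)
  fix c
  assume "coeff (x - y) c \<noteq> 0"
  then have "coeff x c \<noteq> 0 \<or> coeff y c \<noteq> 0"
    by (auto simp: coeff_diff)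
  then show "c = b \<or> c \<lless> b"
    using assms(1,2) by (auto simp: leads_def below_def)
qed (use assms in \<open>simp add: coeff_diff\<close>)

lemma below_coeff: "below b x \<Longrightarrow> coeff x b = 0"
  using less_irrefl by (auto simp: below_def)

text \<open>
  Descent along the well-order: an element can be assumed to be handled as soon as subtracting
  something harmless from it kills its leading term.
\<close>

lemma leads_induct [consumes 1, case_names zero step]:
  assumes "Q x"
    and zero: "Q 0 \<Longrightarrow> R 0"
    and step: "\<And>x b. Q x \<Longrightarrow> leads b x \<Longrightarrow>
      (\<And>y. Q y \<Longrightarrow> below b y \<Longrightarrow> R y) \<Longrightarrow> R x"
  shows "R x"
proof -
  have *: "\<forall>x. leads b x \<longrightarrow> Q x \<longrightarrow> R x" for b
    using wfp_less
  proof (induction b rule: wfp_induct_rule)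
    case (less b)
    have "R y" if "Q y" "below b y" for y
    proof (cases "y = 0")
      case False
      then obtain c where "leads c y"
        using leads_exists by blast
      then show ?thesis
        using less[of c] below_imp_leads_less[OF that(2)] that(1) by simp
    qed (use that zero in simp)
    then show ?case
      by (auto intro: step)
  qed
  show ?thesis
  proof (cases "x = 0")
    case False
    then show ?thesis
      using * leads_exists assms(1) by blast
  qed (use assms in simp)
qed

text \<open>
  Triangular families are independent: the highest of the leading basis vectors occurs in only
  one summand, and nothing can cancel it.
\<close>

lemma sum_distinct_leads_eq_0:
  assumes "finite T" "sum v T = 0"
    and distinct: "\<And>b g h. g \<in> T \<Longrightarrow> h \<in> T \<Longrightarrow> leads b (v g) \<Longrightarrow> leads b (v h) \<Longrightarrow> g = h"
    and "g \<in> T"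
  shows "v g = 0"
proof (rule ccontr)
  assume "v g \<noteq> 0"
  define lev where "lev g = (SOME b. leads b (v g))" for g
  have lev: "leads (lev g) (v g)" if "v g \<noteq> 0" for g
    unfolding lev_def using leads_exists[OF that] by (rule someI_ex)
  define A where "A = lev ` {g\<in>T. v g \<noteq> 0}"
  have "finite A" "A \<noteq> {}"
    using \<open>finite T\<close> \<open>v g \<noteq> 0\<close> \<open>g \<in> T\<close> by (auto simp: A_def)
  from finite_has_greatest[OF this] obtain h
    where h: "h \<in> T" "v h \<noteq> 0" and top: "\<forall>c\<in>A. c = lev h \<or> c \<lless> lev h"
    by (auto simp: A_def)
  have "coeff (v g) (lev h) = 0" if g: "g \<in> T - {h}" for g
  proof (cases "v g = 0")
    case False
    then have "lev g \<noteq> lev h"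
      using g h distinct lev by (metis DiffD1 DiffD2 insertI1)
    then have "lev g \<lless> lev h"
      using False g top by (auto simp: A_def)
    then show ?thesis
      using lev[OF False] leads_imp_below below_coeff by blast
  qed (simp add: coeff_0)
  moreover have "coeff (sum v S) b = (\<Sum>g\<in>S. coeff (v g) b)" for S b
    by (induction S rule: infinite_finite_induct) (auto simp: coeff_0 coeff_add)
  ultimately have "coeff (sum v T) (lev h) = coeff (v h) (lev h)"
    using h \<open>finite T\<close> by (simp add: sum.remove coeff_add)
  then show False
    using lev[OF h(2)] assms(2) by (simp add: leads_def coeff_0)
qed

definition lead_generator :: "'m set \<Rightarrow> 'b \<Rightarrow> 'm \<Rightarrow> bool"
  where "lead_generator P b x \<longleftrightarrow> x \<in> P \<and> leads b x \<and> 0 < coeff x b \<and>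
    (\<forall>y\<in>P. leads b y \<longrightarrow> coeff x b dvd coeff y b)"

text \<open>
  The leading coefficients at \<open>b\<close> of a subgroup of \<open>M\<close> form, together with 0, a subgroup of the
  integers, hence consist of the multiples of its smallest positive element.
\<close>

lemma lead_generator_exists:
  assumes P: "subspace P" and y: "y \<in> P" "leads b y"
  shows "\<exists>x. lead_generator P b x"
proof -
  define C where "C = {x \<in> P. leads b x \<and> 0 < coeff x b}"
  have "y \<in> C \<or> - y \<in> C"
    using y subspace_neg[OF P] by (auto simp: C_def leads_def coeff_uminus)
  then obtain x where x: "x \<in> C" and min: "\<And>z. z \<in> C \<Longrightarrow> nat (coeff x b) \<le> nat (coeff z b)"
    using ex_has_least_nat[of "\<lambda>x. x \<in> C" _ "\<lambda>x. nat (coeff x b)"] by blast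
  have "coeff x b dvd coeff z b" if z: "z \<in> P" "leads b z" for z
  proof (rule ccontr)
    assume ndvd: "\<not> coeff x b dvd coeff z b"
    define w where "w = z - (coeff z b div coeff x b) *z x"
    have c: "coeff w b = coeff z b mod coeff x b"
      by (simp add: w_def coeff_diff coeff_smul minus_div_mult_eq_mod)
    have "coeff w b < coeff x b" "coeff w b \<ge> 0" "coeff w b \<noteq> 0"
      using ndvd x by (auto simp: c C_def dvd_eq_mod_eq_0)
    then have "coeff w b > 0" "coeff w b < coeff x b"
      by auto
    moreover have "w \<in> P"
      unfolding w_def using P z x by (auto simp: C_def intro: subspace_diff subspace_scale)
    moreover have "leads b w"
      unfolding w_def
    proof (rule leads_diff)
      show "leads b z"
        by fact
      show "leads b ((coeff z b div coeff x b) *z x) \<or> below b ((coeff z b div coeff x b) *z x)"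
        using x by (cases "coeff z b div coeff x b = 0") (auto simp: C_def below_0 leads_smul_iff)
      show "coeff z b \<noteq> coeff ((coeff z b div coeff x b) *z x) b"
        using calculation(1) by (simp add: w_def coeff_diff)
    qed
    ultimately show False
      using min[of w] by (auto simp: C_def)
  qed
  then show ?thesis
    using x unfolding lead_generator_def C_def by auto
qed

lemma lead_generator_coeff_eq:
  assumes "lead_generator P b x" "lead_generator P b y"
  shows "coeff x b = coeff y b"
  by (rule zdvd_antisym_nonneg) (use assms in \<open>auto simp: lead_generator_def\<close>)

end

section \<open>Matching the leading terms of the two traces\<close>

context ordered_coordinates
begin

definition involution :: "('m \<Rightarrow> 'm) \<Rightarrow> bool"
  where "involution s \<longleftrightarrow> (\<forall>x y. s (x + y) = s x + s y) \<and>
    (\<forall>k x. s (k *z x) = k *z s x) \<and> (\<forall>x. s (s x) = x)"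

text \<open>
  The involution \<open>- s\<close> has the roles of \<open>1 + s\<close> and \<open>1 - s\<close> exchanged. All notions take the
  involution as an argument, so that a statement about \<open>1 + s\<close> can be reused for \<open>1 - s\<close>. Below,
  \<open>(1 + s) z\<close> and \<open>(1 - s) z\<close> are called the plus part and the minus part of \<open>z\<close>.
\<close>

definition neg :: "('m \<Rightarrow> 'm) \<Rightarrow> 'm \<Rightarrow> 'm"
  where "neg s x = - s x"

definition tr :: "('m \<Rightarrow> 'm) \<Rightarrow> 'm \<Rightarrow> 'm"
  where "tr s x = x + s x"

lemma neg_neg: "neg (neg s) = s"
  by (simp add: neg_def fun_eq_iff)

lemma two_smul: "2 *z x = x + x"
  using scale_left_distrib[of 1 1 x] by simp

text \<open>
  Plus parts are normalised to the smallest positive leading coefficient that occurs in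
  \<open>(1 + s) M\<close> at \<open>b\<close>; inside this subgroup it plays the role of the leading coefficient 1.
\<close>

definition monic :: "('m \<Rightarrow> 'm) \<Rightarrow> 'b \<Rightarrow> 'm \<Rightarrow> bool"
  where "monic s b z \<longleftrightarrow> lead_generator (range (tr s)) b (tr s z)"

text \<open>
  The last two conditions say that \<open>b\<close> and \<open>c\<close> cannot be separated: an element whose plus part
  is as good as that of \<open>z\<close> at \<open>b\<close> has a minus part that reaches \<open>c\<close>, and conversely. They make
  the matching between \<open>b\<close> and \<open>c\<close> one-to-one and symmetric under \<open>s \<mapsto> - s\<close>.
\<close>

definition linked :: "('m \<Rightarrow> 'm) \<Rightarrow> 'b \<Rightarrow> 'b \<Rightarrow> 'm \<Rightarrow> bool"
  where "linked s b c z \<longleftrightarrow> monic s b z \<and> monic (neg s) c z \<and>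
    (\<forall>y. monic s b y \<longrightarrow> \<not> below c (tr (neg s) y)) \<and>
    (\<forall>y. monic (neg s) c y \<longrightarrow> \<not> below b (tr s y))"

text \<open>
  One element is chosen for each leading basis vector, respectively for each linked pair; it is
  this choice that makes distinct generators have distinct leading basis vectors.
\<close>

definition fixed_generators :: "('m \<Rightarrow> 'm) \<Rightarrow> 'm set"
  where "fixed_generators s = {SOME z. s z = z \<and> monic s b z | b. \<exists>z. s z = z \<and> monic s b z}"

definition linked_generators :: "('m \<Rightarrow> 'm) \<Rightarrow> 'm set"
  where "linked_generators s = {SOME z. linked s b c z | b c. \<exists>z. linked s b c z}"

lemma linked_neg: "linked (neg s) c b z \<longleftrightarrow> linked s b c z"
  by (auto simp: linked_def neg_neg)

lemma monic_leads: "monic s b z \<Longrightarrow> leads b (tr s z)"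
  by (simp add: monic_def lead_generator_def)

text \<open>
  If \<open>b\<close> were linked with \<open>c\<close> and with a higher \<open>c'\<close>, the element for \<open>c\<close> would have its minus
  part below \<open>c'\<close>, which the link from \<open>b\<close> to \<open>c'\<close> forbids.
\<close>

lemma linked_unique_right:
  assumes "linked s b c y" "linked s b c' z"
  shows "c = c'"
proof -
  have "\<not> c \<lless> c'" if "linked s b c y" "linked s b c' z" for c c' y z
  proof
    assume "c \<lless> c'"
    then have "below c' (tr (neg s) y)"
      using that(1) leads_imp_below[OF monic_leads] by (auto simp: linked_def)
    then show False
      using that by (auto simp: linked_def)
  qed
  from this[OF assms] this[OF assms(2,1)] show ?thesis
    using total_less by auto
qed

lemma linked_generators_neg: "linked_generators (neg s) = linked_generators s"
  unfolding linked_generators_def linked_neg by blast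

lemma monic_multiple:
  assumes "monic s b z" "leads b (tr s y)"
  obtains k where "coeff (tr s y) b = k * coeff (tr s z) b"
  using assms unfolding monic_def lead_generator_def by (auto elim!: dvdE simp: mult.commute)

lemma tr_neg_eq_0_iff: "tr (neg s) z = 0 \<longleftrightarrow> s z = z"
  by (auto simp: tr_def neg_def)

lemma tr_eq_0_iff: "tr s z = 0 \<longleftrightarrow> s z = - z"
  by (auto simp: tr_def eq_neg_iff_add_eq_0 add.commute)

end

locale involution_coordinates = ordered_coordinates smul coeff less
  for smul :: "int \<Rightarrow> 'm::ab_group_add \<Rightarrow> 'm" (infixr \<open>*z\<close> 75)
    and coeff :: "'m \<Rightarrow> 'b \<Rightarrow> int" and less :: "'b \<Rightarrow> 'b \<Rightarrow> bool" (infix \<open>\<lless>\<close> 50) +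
  fixes s :: "'m \<Rightarrow> 'm"
  assumes involution: "involution s"
begin

lemma s_add: "s (x + y) = s x + s y" and s_smul: "s (k *z x) = k *z s x" and s_s: "s (s x) = x"
  using involution by (auto simp: involution_def)

lemma s_0: "s 0 = 0"
  using s_add[of 0 0] by simp

lemma s_uminus: "s (- x) = - s x"
  using s_add[of x "- x"] by (simp add: s_0 eq_neg_iff_add_eq_0 add.commute)

lemma s_diff: "s (x - y) = s x - s y"
  using s_add[of x "- y"] by (simp add: s_uminus)

lemma tr_0: "tr s 0 = 0"
  by (simp add: tr_def s_0)

lemma tr_add: "tr s (x + y) = tr s x + tr s y"
  by (simp add: tr_def s_add)

lemma tr_diff: "tr s (x - y) = tr s x - tr s y"
  by (simp add: tr_def s_diff)

lemma tr_smul: "tr s (k *z x) = k *z tr s x"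
  by (simp add: tr_def s_smul scale_right_distrib)

lemma tr_sum: "tr s (sum f A) = (\<Sum>a\<in>A. tr s (f a))"
  by (induction A rule: infinite_finite_induct) (auto simp: tr_add tr_0)

lemma tr_s: "tr s (s x) = tr s x"
  by (simp add: tr_def s_s add.commute)

lemma s_tr: "s (tr s x) = tr s x"
  by (simp add: tr_def s_add s_s add.commute)

lemma tr_neg_tr: "tr (neg s) (tr s x) = 0"
  by (simp add: tr_neg_eq_0_iff s_tr)

lemma tr_tr: "tr s (tr s x) = 2 *z tr s x"
  by (simp add: tr_def s_add s_s two_smul add.commute)

lemma involution_neg: "involution_coordinates smul coeff less (neg s)"
  by unfold_locales (simp add: involution_def neg_def s_add s_smul s_uminus s_s)

lemma subspace_range_tr: "subspace (range (tr s))"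
proof (rule subspaceI)
  show "0 \<in> range (tr s)"
    by (rule range_eqI[of _ _ 0]) (simp add: tr_def s_0)
qed (auto simp flip: tr_add tr_smul)

lemma monic_exists: "leads b (tr s y) \<Longrightarrow> \<exists>z. monic s b z"
  using lead_generator_exists[OF subspace_range_tr, of "tr s y" b]
  unfolding monic_def lead_generator_def by auto

lemma monicI:
  assumes "monic s b z" "leads b (tr s y)" "coeff (tr s y) b = coeff (tr s z) b"
  shows "monic s b y"
  using assms by (auto simp: monic_def lead_generator_def)

lemma monic_diff:
  assumes "monic s b z" "below b (tr s y)"
  shows "monic s b (z - y)"
proof (rule monicI[OF assms(1)])
  have "coeff (tr s z) b \<noteq> 0"
    using monic_leads[OF assms(1)] by (simp add: leads_def)
  then show "leads b (tr s (z - y))"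
    using leads_diff[of b "tr s z" "tr s y"] assms monic_leads by (simp add: tr_diff below_coeff)
  show "coeff (tr s (z - y)) b = coeff (tr s z) b"
    using assms(2) by (simp add: tr_diff coeff_diff below_coeff)
qed

lemma tr_diff_smul_tr: "tr s (z - k *z tr s w) = tr s z - (2 * k) *z tr s w"
  by (simp add: tr_diff tr_smul tr_tr mult.commute)

text \<open>
  Since \<open>(1 + s)\<close> doubles \<open>(1 + s) w\<close>, subtracting multiples of \<open>(1 + s) w\<close> from \<open>z\<close> changes the
  leading coefficient of \<open>(1 + s) z\<close> by even multiples of that of \<open>(1 + s) w\<close>. Hence parity is
  the only obstruction to cancelling the leading term, and in the odd case the remainder is
  \<open>(1 + s) w\<close> itself up to lower terms.
\<close>

lemma below_reduce_even:
  assumes "monic s b w" "leads b (tr s z)" "coeff (tr s z) b = k * coeff (tr s w) b" "even k"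
  shows "below b (tr s (z - (k div 2) *z tr s w))"
  using below_diff_smul[OF assms(2) monic_leads[OF assms(1)] assms(3)] \<open>even k\<close>
  by (simp add: tr_diff_smul_tr)

lemma monic_reduce_odd:
  assumes w: "monic s b w" and z: "leads b (tr s z)"
    and k: "coeff (tr s z) b = k * coeff (tr s w) b" "odd k"
  shows "monic s b (z - (k div 2) *z tr s w)"
proof (rule monicI[OF w])
  have "2 * (k div 2) = k - 1"
    using \<open>odd k\<close> by presburger
  then have tr: "tr s (z - (k div 2) *z tr s w) = tr s z - (k - 1) *z tr s w"
    by (simp add: tr_diff_smul_tr)
  show coeff: "coeff (tr s (z - (k div 2) *z tr s w)) b = coeff (tr s w) b"
    by (simp add: tr coeff_diff coeff_smul k left_diff_distrib)
  show "leads b (tr s (z - (k div 2) *z tr s w))"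
    unfolding tr
  proof (rule leads_diff[OF z])
    show "leads b ((k - 1) *z tr s w) \<or> below b ((k - 1) *z tr s w)"
      using monic_leads[OF w] by (cases "k = 1") (auto simp: below_0 leads_smul_iff)
    show "coeff (tr s z) b \<noteq> coeff ((k - 1) *z tr s w) b"
      using coeff monic_leads[OF w] by (auto simp: tr coeff_diff leads_def)
  qed
qed

end

context involution_coordinates
begin

interpretation neg: involution_coordinates smul coeff less "neg s"
  by (rule involution_neg)

lemma tr_tr_neg: "tr s (tr (neg s) x) = 0"
  using neg.tr_neg_tr[of x] by (simp add: neg_neg)

text \<open>
  This is the step that pairs plus parts with minus parts. Among the \<open>z\<close> that are monic at \<open>b\<close>,
  one is taken whose minus part is lowest, say with leading basis vector \<open>c\<close>. Reduction modulo
  minus parts leaves the plus part unchanged, so minimality excludes the even case, and the odd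
  case produces an element that is monic at \<open>c\<close> as well. If a monic element for \<open>c\<close> had a plus
  part below \<open>b\<close>, its difference with this element would contradict minimality.
\<close>

lemma fixed_or_linked:
  assumes "leads b (tr s y)"
  shows "(\<exists>z. s z = z \<and> monic s b z) \<or> (\<exists>c z. linked s b c z)"
proof (rule disjCI[THEN disj_commute[THEN iffD1]])
  assume "\<not> (\<exists>z. s z = z \<and> monic s b z)"
  then have nonzero: "tr (neg s) z \<noteq> 0" if "monic s b z" for z
    using that by (simp add: tr_neg_eq_0_iff) blast
  define C where "C = {c. \<exists>z. monic s b z \<and> leads c (tr (neg s) z)}"
  obtain z\<^sub>0 where "monic s b z\<^sub>0"
    using monic_exists[OF assms] by blast
  then have "\<exists>c. c \<in> C"
    using leads_exists[OF nonzero[of z\<^sub>0]] by (auto simp: C_def)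
  then obtain c where "c \<in> C" and min: "\<And>d. d \<lless> c \<Longrightarrow> d \<notin> C"
    using wfp_less[unfolded wfp_eq_minimal, rule_format, of _ C] by auto
  then obtain z where z: "monic s b z" "leads c (tr (neg s) z)"
    by (auto simp: C_def)
  have not_below: "\<not> below c (tr (neg s) y)" if "monic s b y" for y
  proof
    assume "below c (tr (neg s) y)"
    moreover obtain d where "leads d (tr (neg s) y)"
      using nonzero[OF \<open>monic s b y\<close>] leads_exists by blast
    ultimately show False
      using min[of d] that below_imp_leads_less by (auto simp: C_def)
  qed
  obtain w where w: "monic (neg s) c w"
    using neg.monic_exists[OF z(2)] by blast
  obtain k where k: "coeff (tr (neg s) z) c = k * coeff (tr (neg s) w) c"
    using monic_multiple[OF w z(2)] .
  \<comment> \<open>The multiple \<open>k div 2\<close> suffices because the minus part of a minus part is its double.\<close>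
  define v where "v = z - (k div 2) *z tr (neg s) w"
  have "monic s b v"
    unfolding v_def using monic_diff[OF z(1)] by (simp add: tr_smul tr_tr_neg below_0)
  moreover have "odd k"
    using not_below[OF \<open>monic s b v\<close>] neg.below_reduce_even[OF w z(2) k] by (auto simp: v_def)
  ultimately have v: "monic s b v" "monic (neg s) c v"
    using neg.monic_reduce_odd[OF w z(2) k] by (simp_all add: v_def)
  have "\<not> below b (tr s y)" if y: "monic (neg s) c y" for y
  proof
    assume "below b (tr s y)"
    then have "monic s b (v - y)"
      using monic_diff v(1) by blast
    moreover have "below c (tr (neg s) (v - y))"
      using below_diff_smul[of c "tr (neg s) v" "tr (neg s) y" 1] v(2) y
      by (simp add: monic_leads neg.tr_diff
          lead_generator_coeff_eq[OF v(2)[unfolded monic_def] y[unfolded monic_def]])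
    ultimately show False
      using not_below by blast
  qed
  then have "linked s b c v"
    using v not_below by (auto simp: linked_def)
  then show "\<exists>c z. linked s b c z"
    by blast
qed

text \<open>
  A fixed generator and a linked one cannot share the leading basis vector of their plus parts,
  because a link from \<open>b\<close> to \<open>c\<close> forbids elements that are monic at \<open>b\<close> with minus part 0, which
  is below every \<open>c\<close>.
\<close>

lemma generators:
  shows fixed_generators_fixed: "g \<in> fixed_generators s \<Longrightarrow> s g = g"
    and linked_generators_linked: "g \<in> linked_generators s \<Longrightarrow> \<exists>b c. linked s b c g"
    and generators_lead: "g \<in> fixed_generators s \<union> linked_generators s \<Longrightarrow> \<exists>b. leads b (tr s g)"
    and generators_exist: "leads b (tr s y) \<Longrightarrow> \<exists>g\<in>fixed_generators s \<union> linked_generators s. monic s b g"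
    and generators_distinct: "g \<in> fixed_generators s \<union> linked_generators s \<Longrightarrow>
      h \<in> fixed_generators s \<union> linked_generators s \<Longrightarrow>
      leads b (tr s g) \<Longrightarrow> leads b (tr s h) \<Longrightarrow> g = h"
proof -
  define f where "f b = (SOME z. s z = z \<and> monic s b z)" for b
  define l where "l b c = (SOME z. linked s b c z)" for b c
  have f: "s (f b) = f b" "monic s b (f b)" if "\<exists>z. s z = z \<and> monic s b z" for b
    using someI_ex[OF that] by (simp_all add: f_def)
  have l: "linked s b c (l b c)" if "\<exists>z. linked s b c z" for b c
    using someI_ex[OF that] by (simp add: l_def)
  define G1 where "G1 = fixed_generators s"
  define G3 where "G3 = linked_generators s"
  note G_defs = G1_def [symmetric] G3_def [symmetric]
  have G1: "G1 = {f b | b. \<exists>z. s z = z \<and> monic s b z}"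
    and G3: "G3 = {l b c | b c. \<exists>z. linked s b c z}"
    by (simp_all add: G1_def G3_def fixed_generators_def linked_generators_def f_def l_def)
  show "s g = g" if "g \<in> fixed_generators s" for g
    using f that by (auto simp: G1 G_defs)
  show "\<exists>b c. linked s b c g" if "g \<in> linked_generators s" for g
    using l that unfolding G3 G_defs by blast
  have m1: "\<exists>b. monic s b g \<and> s g = g \<and> g = f b" if "g \<in> G1" for g
    using that f unfolding G1 by blast
  have m3: "\<exists>b c. linked s b c g \<and> monic s b g \<and> g = l b c" if "g \<in> G3" for g
    using that l unfolding G3 linked_def by blast
  show "\<exists>b. leads b (tr s g)" if "g \<in> fixed_generators s \<union> linked_generators s" for g
    using m1 m3 monic_leads that unfolding G_defs by blast
  show "\<exists>g\<in>fixed_generators s \<union> linked_generators s. monic s b g" if leads_y: "leads b (tr s y)" for b y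
  proof -
    consider "\<exists>z. s z = z \<and> monic s b z" | c where "\<exists>z. linked s b c z"
      using fixed_or_linked[OF leads_y] by blast
    then show ?thesis
    proof cases
      case 1
      then have "f b \<in> G1" "monic s b (f b)"
        using f by (auto simp: G1)
      then show ?thesis
        unfolding G_defs by blast
    next
      case 2
      then have "l b c \<in> G3"
        unfolding G3 by blast
      moreover have "monic s b (l b c)"
        using l[OF 2] by (simp add: linked_def)
      ultimately show ?thesis
        unfolding G_defs by blast
    qed
  qed
  have 13: "\<not> (leads b (tr s g) \<and> leads b (tr s h))" if "g \<in> G1" "h \<in> G3" for g h b
  proof
    assume leads: "leads b (tr s g) \<and> leads b (tr s h)"
    obtain d where d: "monic s d g" "s g = g"
      using m1 \<open>g \<in> G1\<close> by blast
    obtain e c where e: "linked s e c h" "monic s e h"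
      using m3 \<open>h \<in> G3\<close> by blast
    have "d = b" "e = b"
      using leads_unique[OF monic_leads[OF d(1)], of b] leads_unique[OF monic_leads[OF e(2)], of b]
        leads by simp_all
    moreover have "below c (tr (neg s) g)"
      using d(2) tr_neg_eq_0_iff[of s g] by (simp add: below_0)
    ultimately show False
      using d e by (simp add: linked_def)
  qed
  have 11: "g = h" if "g \<in> G1" "h \<in> G1" and 
      leads: "leads b (tr s g)" "leads b (tr s h)" for g h b
  proof -
    obtain d where d: "monic s d g" "g = f d"
      using m1 \<open>g \<in> G1\<close> by blast
    obtain e where e: "monic s e h" "h = f e"
      using m1 \<open>h \<in> G1\<close> by blast
    have "d = b" "e = b"
      using leads_unique[OF monic_leads[OF d(1)] leads(1)]
        leads_unique[OF monic_leads[OF e(1)] leads(2)] by simp_all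
    then show ?thesis
      using d e by simp
  qed
  have 33: "g = h" if "g \<in> G3" "h \<in> G3" and 
      leads: "leads b (tr s g)" "leads b (tr s h)" for g h b
  proof -
    obtain d c where d: "linked s d c g" "monic s d g" "g = l d c"
      using m3 \<open>g \<in> G3\<close> by blast
    obtain e c' where e: "linked s e c' h" "monic s e h" "h = l e c'"
      using m3 \<open>h \<in> G3\<close> by blast
    have "d = b" "e = b"
      using leads_unique[OF monic_leads[OF d(2)] leads(1)]
        leads_unique[OF monic_leads[OF e(2)] leads(2)] by simp_all
    then show ?thesis
      using d e linked_unique_right[of s b c g c' h] by simp
  qed
  show "g = h"
    if "g \<in> fixed_generators s \<union> linked_generators s" "h \<in> fixed_generators s \<union> linked_generators s"
      and "leads b (tr s g)" "leads b (tr s h)" for g h b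
    using that 11 13 33 unfolding G_defs by blast
qed

end

section \<open>Generators of the summands\<close>

context involution_coordinates
begin

interpretation neg: involution_coordinates smul coeff less "neg s"
  by (rule involution_neg)

definition generators :: "'m set"
  where "generators = fixed_generators s \<union> fixed_generators (neg s) \<union> linked_generators s"

lemma neg_fixed_generators: "g \<in> fixed_generators (neg s) \<Longrightarrow> s g = - g"
  using neg.fixed_generators_fixed[of g] by (simp add: neg_def minus_equation_iff)

lemma generators_nonzero:
  assumes "g \<in> generators"
  shows "g \<noteq> 0"
  using assms generators_lead[of g] neg.generators_lead[of g] leads_nonzero[of _ 0]
  by (auto simp: generators_def tr_0 neg.tr_0)

text \<open>
  Subtracting multiples of generators lowers the plus part of an element until it vanishes, and
  thus reduces the claim to elements \<open>y\<close> with \<open>s y = - y\<close>. For these \<open>2 y\<close> is a minus part. If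
  its leading basis vector \<open>c\<close> belongs to an anti-fixed generator, \<open>y\<close> can be lowered by a
  multiple of it. If it belongs to a linked generator \<open>g\<close>, the coefficient of \<open>2 y\<close> must be an
  even multiple of that of \<open>(1 - s) g\<close>: otherwise reduction would give an anti-fixed element
  that is monic at \<open>c\<close>, contrary to the link. So \<open>y\<close> itself can be lowered by a multiple of
  \<open>(1 - s) g\<close>.
\<close>

lemma generators_span:
  assumes U: "subspace U" "\<And>x. x \<in> U \<Longrightarrow> s x \<in> U" and gens: "generators \<subseteq> U"
  shows "U = UNIV"
proof -
  have anti: "y \<in> U" if "s y = - y" for y
    using that
  proof (induction y rule: leads_induct)
    case zero
    show ?case
      using U(1) by (rule subspace_0)
  next
    case (step y c)
    have tr_y: "tr (neg s) y = 2 *z y"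
      using step(1) by (simp add: tr_def neg_def two_smul)
    \<comment> \<open>One step of the descent, by an anti-fixed \<open>x\<close> with the same leading basis vector as \<open>y\<close>.\<close>
    have lower: "y \<in> U" if x: "x \<in> U" "s x = - x" "leads c x" and k: "coeff y c = k * coeff x c" for k x
    proof -
      have "s (y - k *z x) = - (y - k *z x)"
        using step(1) x(2) by (simp add: s_diff s_smul)
      then have "y - k *z x \<in> U"
        using step(3) below_diff_smul[OF step(2) x(3) k] by blast
      then show ?thesis
        using subspace_add[OF U(1), of "y - k *z x" "k *z x"] subspace_scale[OF U(1) x(1)] by simp
    qed
    have lead: "leads c (tr (neg s) y)"
      using step(2) by (simp add: tr_y leads_smul_iff)
    then obtain g where g: "g \<in> fixed_generators (neg s) \<union> linked_generators s" "monic (neg s) c g"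
      using neg.generators_exist linked_generators_neg by metis
    then obtain k where k: "coeff (tr (neg s) y) c = k * coeff (tr (neg s) g) c"
      using monic_multiple lead by blast
    have "g \<in> U"
      using g gens by (auto simp: generators_def)
    show ?case
    proof (cases "g \<in> fixed_generators (neg s)")
      case True
      then have sg: "s g = - g"
        by (rule neg_fixed_generators)
      then have tr_g: "tr (neg s) g = 2 *z g"
        by (simp add: tr_def neg_def two_smul)
      show ?thesis
      proof (rule lower[OF \<open>g \<in> U\<close> sg])
        show "leads c g"
          using monic_leads[OF g(2)] by (simp add: tr_g leads_smul_iff)
        show "coeff y c = k * coeff g c"
          using k by (simp add: tr_y tr_g coeff_smul)
      qed
    next
      case False
      then obtain b c' where "linked s b c' g"
        using g linked_generators_linked by blast
      moreover from this have "c' = c"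
        using g(2) leads_unique[OF monic_leads monic_leads] by (auto simp: linked_def)
      ultimately have linked: "linked s b c g"
        by simp
      define D where "D = tr (neg s) g"
      have D: "D \<in> U" "s D = - D" "leads c D"
        using \<open>g \<in> U\<close> U monic_leads[OF g(2)] tr_tr_neg[of g]
        by (auto simp: D_def tr_eq_0_iff) (simp add: tr_def neg_def subspace_diff)
      have "even k"
      proof (rule ccontr)
        assume "odd k"
        define x where "x = y - (k div 2) *z D"
        have "monic (neg s) c x"
          unfolding x_def D_def by (rule neg.monic_reduce_odd[OF g(2) lead k \<open>odd k\<close>])
        moreover have "s x = - x"
          using step(1) D(2) by (simp add: x_def s_diff s_smul)
        then have "below b (tr s x)"
          using tr_eq_0_iff[of s x] by (simp add: below_0)
        ultimately show False
          using linked by (simp add: linked_def)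
      qed
      show ?thesis
      proof (rule lower[OF D])
        show "coeff y c = (k div 2) * coeff D c"
          using k \<open>even k\<close> by (auto simp: tr_y coeff_smul D_def)
      qed
    qed
  qed
  have "\<forall>y. tr s y = x \<longrightarrow> y \<in> U" for x
    using TrueI
  proof (induction x rule: leads_induct[where Q = "\<lambda>_. True"])
    case zero
    show ?case
      using anti tr_eq_0_iff by blast
  next
    case (step x b)
    show ?case
    proof (intro allI impI)
      fix y
      assume y: "tr s y = x"
      then obtain g where g: "g \<in> fixed_generators s \<union> linked_generators s" "monic s b g"
        using generators_exist step(2) by blast
      then obtain k where k: "coeff (tr s y) b = k * coeff (tr s g) b"
        using monic_multiple step(2) y by blast
      have "g \<in> U"
        using g gens by (auto simp: generators_def)
      have "below b (tr s (y - k *z g))"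
        using below_diff_smul[OF _ monic_leads[OF g(2)] k] step(2) y by (simp add: tr_diff tr_smul)
      then have "y - k *z g \<in> U"
        using step(3) by blast
      then show "y \<in> U"
        using subspace_add[OF U(1), of "y - k *z g" "k *z g"] subspace_scale[OF U(1) \<open>g \<in> U\<close>] by simp
    qed
  qed
  then show ?thesis
    by auto
qed

text \<open>
  Applying \<open>1 + s\<close> kills the anti-fixed generators and leaves multiples of a triangular family,
  so the plus part of every term vanishes; the same holds for the minus parts, and an element
  with both parts 0 is 0 because there is no 2-torsion.
\<close>

lemma generators_independent:
  assumes "finite T" "T \<subseteq> generators" and sum: "(\<Sum>g\<in>T. a g *z g + c g *z s g) = 0" and "h \<in> T"
  shows "a h *z h + c h *z s h = 0"
proof -
  let ?y = "\<lambda>g. a g *z g + c g *z s g"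
  have plus: "tr s (?y g) = (a g + c g) *z tr s g" for g
    by (simp add: tr_add tr_smul tr_s scale_left_distrib)
  have "tr s (?y h) = 0"
  proof (rule sum_distinct_leads_eq_0[OF \<open>finite T\<close> _ _ \<open>h \<in> T\<close>])
    show "(\<Sum>g\<in>T. tr s (?y g)) = 0"
      using sum by (simp add: tr_0 flip: tr_sum)
    have *: "g \<in> fixed_generators s \<union> linked_generators s"
      if "g \<in> T" "leads b (tr s (?y g))" for g b
    proof (rule ccontr)
      assume "\<not> ?thesis"
      then have "tr s g = 0"
        using that assms(2) by (auto simp: generators_def tr_eq_0_iff neg_fixed_generators)
      then show False
        using that by (simp add: plus leads_def coeff_0)
    qed
    fix b g g'
    assume "g \<in> T" "g' \<in> T" "leads b (tr s (?y g))" "leads b (tr s (?y g'))"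
    then show "g = g'"
      using *[of g b] *[of g' b] generators_distinct[of g g' b] by (auto simp: plus leads_smul_iff)
  qed
  have minus: "tr (neg s) (?y g) = (a g - c g) *z tr (neg s) g" for g
    by (simp add: tr_def neg_def s_add s_smul s_s algebra_simps)
  have "tr (neg s) (?y h) = 0"
  proof (rule sum_distinct_leads_eq_0[OF \<open>finite T\<close> _ _ \<open>h \<in> T\<close>])
    show "(\<Sum>g\<in>T. tr (neg s) (?y g)) = 0"
      using sum by (simp add: neg.tr_0 flip: neg.tr_sum)
    have *: "g \<in> fixed_generators (neg s) \<union> linked_generators s"
      if "g \<in> T" "leads b (tr (neg s) (?y g))" for g b
    proof (rule ccontr)
      assume "\<not> ?thesis"
      then have "tr (neg s) g = 0"
        using that assms(2) by (auto simp: generators_def tr_neg_eq_0_iff fixed_generators_fixed)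
      then show False
        using that by (simp add: minus leads_def coeff_0)
    qed
    fix b g g'
    assume "g \<in> T" "g' \<in> T" "leads b (tr (neg s) (?y g))" "leads b (tr (neg s) (?y g'))"
    then show "g = g'"
      using *[of g b] *[of g' b] neg.generators_distinct[of g g' b]
      by (auto simp: minus leads_smul_iff linked_generators_neg)
  qed
  then have "s (?y h) = ?y h"
    by (simp add: tr_neg_eq_0_iff)
  with \<open>tr s (?y h) = 0\<close> have "2 *z ?y h = 0"
    by (simp add: tr_def two_smul)
  then show ?thesis
    by (simp add: smul_eq_0_iff)
qed

end

section \<open>Existence of the decomposition\<close>

text \<open>
  A criterion with ordinary finite sums in place of finitely supported families.
\<close>

lemma direct_sum_decompositionI:
  fixes N :: "'i \<Rightarrow> 'm::ab_group_add set"
  assumes "module scale" and sub: "\<And>i. i \<in> I \<Longrightarrow> module.subspace scale (N i)"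
    and ex: "\<And>x. \<exists>T y. finite T \<and> T \<subseteq> I \<and> (\<forall>i\<in>T. y i \<in> N i) \<and> x = sum y T"
    and indep: "\<And>T y i. finite T \<Longrightarrow> T \<subseteq> I \<Longrightarrow> (\<forall>i\<in>T. y i \<in> N i) \<Longrightarrow> sum y T = 0 \<Longrightarrow> i \<in> T \<Longrightarrow> y i = 0"
  shows "direct_sum_decomposition scale I N"
  unfolding direct_sum_decomposition_def
proof (intro conjI ballI allI ex_ex1I)
  interpret module scale
    by fact
  fix x
  obtain T y where T: "finite T" "T \<subseteq> I" "\<And>i. i \<in> T \<Longrightarrow> y i \<in> N i" and x: "x = sum y T"
    using ex[of x] by blast
  define f where "f = Abs_poly_mapping (\<lambda>i. y i when i \<in> T)"
  have lookup: "lookup f i = (y i when i \<in> T)" for i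
    unfolding f_def using T(1) by (subst lookup_Abs_poly_mapping) (auto simp: when_def)
  then have keys: "keys f = {i\<in>T. y i \<noteq> 0}"
    by (auto simp: in_keys_iff)
  have "x = (\<Sum>i\<in>keys f. lookup f i)"
    unfolding x keys using T(1) by (intro sum.mono_neutral_cong_right) (auto simp: lookup)
  moreover have "lookup f i \<in> N i" if "i \<in> I" for i
    using that T sub subspace_0 by (auto simp: lookup when_def)
  ultimately show "\<exists>f. keys f \<subseteq> I \<and> (\<forall>i\<in>I. lookup f i \<in> N i) \<and> x = (\<Sum>i\<in>keys f. lookup f i)"
    using keys T by (intro exI[of _ f]) auto
next
  interpret module scale
    by fact
  fix x and f g :: "'i \<Rightarrow>\<^sub>0 'm"
  assume f: "keys f \<subseteq> I \<and> (\<forall>i\<in>I. lookup f i \<in> N i) \<and> x = (\<Sum>i\<in>keys f. lookup f i)"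
    and g: "keys g \<subseteq> I \<and> (\<forall>i\<in>I. lookup g i \<in> N i) \<and> x = (\<Sum>i\<in>keys g. lookup g i)"
  let ?T = "keys f \<union> keys g"
  have "(\<Sum>i\<in>keys f. lookup f i) = (\<Sum>i\<in>?T. lookup f i)"
    by (intro sum.mono_neutral_left) (auto simp: in_keys_iff)
  moreover have "(\<Sum>i\<in>keys g. lookup g i) = (\<Sum>i\<in>?T. lookup g i)"
    by (intro sum.mono_neutral_left) (auto simp: in_keys_iff)
  ultimately have sum_0: "(\<Sum>i\<in>?T. lookup f i - lookup g i) = 0"
    using f g by (simp add: sum_subtractf)
  have "lookup f i - lookup g i = 0" if "i \<in> ?T" for i
  proof (rule indep[of ?T "\<lambda>i. lookup f i - lookup g i"])
    have "lookup f i - lookup g i \<in> N i" if "i \<in> I" for i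
      using that f g sub by (simp add: subspace_diff)
    then show "\<forall>i\<in>?T. lookup f i - lookup g i \<in> N i"
      using f g by blast
  qed (use f g that sum_0 in auto)
  moreover have "lookup f i - lookup g i = 0" if "i \<notin> ?T" for i
    using that by (simp add: in_keys_iff)
  ultimately show "f = g"
    by (intro poly_mapping_eqI) (metis right_minus_eq)
qed (rule sub)

lemma free_module_ordered_coordinates:
  fixes smul :: "int \<Rightarrow> 'm::ab_group_add \<Rightarrow> 'm"
  assumes "module smul" "free_module smul"
  shows "\<exists>(coeff :: 'm \<Rightarrow> 'm \<Rightarrow> int) less. ordered_coordinates smul coeff less"
proof -
  interpret module smul
    by fact
  obtain B where B: "independent B" "span B = UNIV"
    using assms(2) by (auto simp: free_module_def)
  obtain r :: "'m rel" where r: "well_order_on UNIV r"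
    using well_order_on by blast
  then have lin: "linear_order r" and wf: "wf (r - Id)"
    by (auto simp: well_order_on_def)
  have "ordered_coordinates smul (representation B) (\<lambda>a b. (a, b) \<in> r - Id)"
  proof unfold_locales
    fix x y :: 'm and k b
    show "representation B (x + y) b = representation B x b + representation B y b"
      by (simp add: representation_add B)
    show "representation B (smul k x) b = k * representation B x b"
      by (simp add: representation_scale B)
    show "finite {b. representation B x b \<noteq> 0}"
      by (rule finite_representation)
    show "x = 0" if "\<And>b. representation B x b = 0"
      using sum_nonzero_representation_eq[OF B(1), of x] B(2) that by simp
    show "wfp (\<lambda>a b. (a, b) \<in> r - Id)"
    proof -
      have "{(a, b). (a, b) \<in> r - Id} = r - Id"
        by auto
      then show ?thesis
        using wf by (simp only: wfp_def)
    qed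
  next
    fix b c d :: 'm
    have "trans r" "antisym r"
      using lin by (auto simp: order_on_defs)
    then show "(b, c) \<in> r - Id \<Longrightarrow> (c, d) \<in> r - Id \<Longrightarrow> (b, d) \<in> r - Id"
      unfolding antisym_def trans_def by blast
    show "(b, c) \<in> r - Id \<or> b = c \<or> (c, b) \<in> r - Id"
      using lin by (auto simp: order_on_defs total_on_def)
  qed
  then show ?thesis
    by blast
qed

locale group_ring_module = module scale for scale :: "group_ring_Z2 \<Rightarrow> 'm::ab_group_add \<Rightarrow> 'm"
begin

abbreviation int_scale :: "int \<Rightarrow> 'm \<Rightarrow> 'm"  (infixr \<open>*z\<close> 75)
  where "int_scale \<equiv> restrict_to_int scale"

abbreviation s :: "'m \<Rightarrow> 'm"
  where "s \<equiv> scale sigma"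

lemma scale_eq: "scale r x = lookup r 0 *z x + lookup r 1 *z s x"
  by (subst group_ring_Z2_eq[of r]) (simp add: restrict_to_int_def scale_left_distrib flip: scale_scale)

lemma s_int_scale: "s (k *z x) = k *z s x"
  by (simp add: restrict_to_int_def mult.commute)

end

text \<open>
  Singletons \<open>{g}\<close> of generators serve as indices, and the summand at \<open>{g}\<close> is the submodule
  spanned by \<open>g\<close>. A fixed generator spans \<open>T1\<close> and an anti-fixed one \<open>T2\<close>, since nonzero
  elements have infinite order. For a linked generator \<open>g\<close> the elements \<open>g\<close> and \<open>s g\<close> are
  independent over the integers, since \<open>(1 + s) g\<close> and \<open>(1 - s) g\<close> are both nonzero; so its
  annihilator is 0 and its span is free of rank one.
\<close>

theorem T_decomposition_exists:
  fixes scale :: "group_ring_Z2 \<Rightarrow> 'm::ab_group_add \<Rightarrow> 'm"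
  assumes "module scale" and "free_module (restrict_to_int scale)"
  shows "\<exists>(I :: 'm set set) N. T_decomposition scale I N"
proof -
  interpret R: group_ring_module scale
    using assms(1) by (rule group_ring_module.intro)
  let ?s = "scale sigma"
  let ?z = "restrict_to_int scale"
  obtain coeff less where "ordered_coordinates ?z (coeff :: 'm \<Rightarrow> 'm \<Rightarrow> int) less"
    using free_module_ordered_coordinates[OF module_restrict_to_int] assms by blast
  then interpret ordered_coordinates ?z coeff less .
  interpret involution_coordinates ?z coeff less ?s
    by unfold_locales (auto simp: involution_def R.scale_right_distrib R.s_int_scale sigma_sigma)
  have "subspace (R.span generators)"
    by (rule subspaceI)
      (auto intro: R.span_zero R.span_add R.span_scale simp: restrict_to_int_def)
  then have span: "R.span generators = UNIV"
    by (rule generators_span) (auto intro: R.span_scale R.span_base)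
  define I where "I = (\<lambda>g. {g}) ` generators"
  have "direct_sum_decomposition scale I R.span"
  proof (rule direct_sum_decompositionI[OF assms(1)])
    fix x
    have "x \<in> R.span generators"
      by (simp add: span)
    then obtain T r where T: "finite T" "T \<subseteq> generators" "x = (\<Sum>g\<in>T. scale (r g) g)"
      unfolding R.span_explicit by blast
    define y where "y i = scale (r (the_elem i)) (the_elem i)" for i
    have "x = sum y ((\<lambda>g. {g}) ` T)"
      unfolding T by (subst sum.reindex) (auto simp: y_def)
    moreover have "\<forall>i\<in>(\<lambda>g. {g}) ` T. y i \<in> R.span i"
      by (auto simp: y_def intro: R.span_scale R.span_base)
    ultimately show "\<exists>T y. finite T \<and> T \<subseteq> I \<and> (\<forall>i\<in>T. y i \<in> R.span i) \<and> x = sum y T"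
      using T unfolding I_def by (intro exI[of _ "(\<lambda>g. {g}) ` T"] exI[of _ y]) auto
  next
    fix T y i
    assume T: "finite T" "T \<subseteq> I" "\<forall>i\<in>T. y i \<in> R.span i" and sum: "sum y T = 0" and i: "i \<in> T"
    define T' where "T' = the_elem ` T"
    have T': "finite T'" "T' \<subseteq> generators"
      using T unfolding T'_def I_def by auto
    have "{the_elem i} = i" if "i \<in> T" for i
      using that T(2) by (auto simp: I_def)
    then have T_eq: "T = (\<lambda>g. {g}) ` T'"
      by (simp add: T'_def image_image)
    have "\<exists>r. y {g} = scale r g" if "g \<in> T'" for g
      using T(3) that by (auto simp: T_eq R.span_singleton)
    then obtain r where r: "\<And>g. g \<in> T' \<Longrightarrow> y {g} = scale (r g) g"
      by metis
    have "(\<Sum>g\<in>T'. lookup (r g) 0 *z g + lookup (r g) 1 *z ?s g) = sum y T"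
      unfolding T_eq by (subst sum.reindex) (auto simp: r simp flip: R.scale_eq)
    moreover obtain g where g: "g \<in> T'" "i = {g}"
      using i T_eq by blast
    ultimately show "y i = 0"
      using generators_independent[OF T', of "\<lambda>g. lookup (r g) 0" "\<lambda>g. lookup (r g) 1" g]
      by (simp add: sum r R.scale_eq[of "r g"])
  qed simp
  moreover have "submodule_iso scale (R.span {g}) T1 \<or> submodule_iso scale (R.span {g}) T2 \<or>
      submodule_iso scale (R.span {g}) T3" if g: "g \<in> generators" for g
  proof -
    have hom: "module_hom T scale f"
      if "module T" "\<And>x y. f (x + y) = f x + f y" "\<And>r x. f (T r x) = scale r (f x)" for T f
      using that assms(1) by (simp add: module_hom_iff)
    have ints: "range (\<lambda>n. n *z g) = R.span {g}" if sg: "?s g = e *z g" for e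
    proof -
      have "scale r g = (lookup r 0 + lookup r 1 * e) *z g" for r
        by (simp add: R.scale_eq[of r] sg scale_left_distrib)
      moreover have "n *z g = scale (of_int n) g" for n
        by (simp add: restrict_to_int_def)
      ultimately show ?thesis
        unfolding R.span_singleton by (metis (no_types, lifting) subset_antisym image_subset_iff rangeI)
    qed
    have inj: "inj (\<lambda>n. n *z g)" if "g \<noteq> 0"
    proof (rule injI)
      fix m n
      assume "m *z g = n *z g"
      then have "(m - n) *z g = 0"
        by (simp add: scale_left_diff_distrib)
      then show "m = n"
        using that by (simp add: smul_eq_0_iff)
    qed
    consider "g \<in> fixed_generators ?s" | "g \<in> fixed_generators (neg ?s)" | "g \<in> linked_generators ?s"
      using g by (auto simp: generators_def)
    then show ?thesis
    proof cases
      case 1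
      then have sg: "?s g = 1 *z g"
        by (simp add: fixed_generators_fixed)
      have "g \<noteq> 0"
        using g by (rule generators_nonzero)
      have "T1 r n *z g = scale r (n *z g)" for r n
        by (simp add: R.scale_eq[of r] R.s_int_scale sg T1_def scale_left_distrib
            scale_left_diff_distrib)
      then have "module_hom T1 scale (\<lambda>n. n *z g)"
        by (intro hom module_T1) (simp_all add: scale_left_distrib)
      then have "submodule_iso scale (R.span {g}) T1"
        using ints[OF sg] inj[OF \<open>g \<noteq> 0\<close>] by (auto simp: submodule_iso_def bij_betw_def)
      then show ?thesis
        by blast
    next
      case 2
      then have sg: "?s g = (- 1) *z g"
        using neg_fixed_generators[of g] by simp
      have "g \<noteq> 0"
        using g by (rule generators_nonzero)
      have "T2 r n *z g = scale r (n *z g)" for r n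
        by (simp add: R.scale_eq[of r] R.s_int_scale sg T2_def scale_left_distrib
            scale_left_diff_distrib)
      then have "module_hom T2 scale (\<lambda>n. n *z g)"
        by (intro hom module_T2) (simp_all add: scale_left_distrib)
      then have "submodule_iso scale (R.span {g}) T2"
        using ints[OF sg] inj[OF \<open>g \<noteq> 0\<close>] by (auto simp: submodule_iso_def bij_betw_def)
      then show ?thesis
        by blast
    next
      case 3
      then obtain b c where linked: "linked ?s b c g"
        using linked_generators_linked by blast
      have nonzero: "tr ?s g \<noteq> 0" "tr (neg ?s) g \<noteq> 0"
        using linked leads_nonzero[OF monic_leads] by (auto simp: linked_def)
      have "r = r'" if eq: "scale r g = scale r' g" for r r'
      proof -
        define q where "q = r - r'"
        have "scale q g = 0"
          using eq by (simp add: q_def R.scale_left_diff_distrib)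
        then have 0: "lookup q 0 *z g + lookup q 1 *z ?s g = 0"
          by (simp add: R.scale_eq[of q])
        have "(lookup q 0 + lookup q 1) *z tr ?s g = 0"
          using arg_cong[OF 0, of "tr ?s"] by (simp add: tr_add tr_smul tr_s tr_0 scale_left_distrib)
        moreover have "(lookup q 0 - lookup q 1) *z tr (neg ?s) g = 0"
          using arg_cong[OF 0, of "tr (neg ?s)"]
          by (simp add: tr_def neg_def s_add s_smul sigma_sigma s_0 algebra_simps)
        ultimately have "lookup q 0 = 0" "lookup q 1 = 0"
          using nonzero by (auto simp: smul_eq_0_iff)
        then have "q = 0"
          using group_ring_Z2_eq[of q] by simp
        then show ?thesis
          by (simp add: q_def)
      qed
      then have "inj (\<lambda>r. scale r g)"
        by (auto simp: inj_def)
      moreover have "module_hom T3 scale (\<lambda>r. scale r g)"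
        by (rule hom[OF module_T3]) (simp_all add: T3_def R.scale_left_distrib)
      ultimately have "submodule_iso scale (R.span {g}) T3"
        by (auto simp: submodule_iso_def bij_betw_def R.span_singleton)
      then show ?thesis
        by blast
    qed
  qed
  ultimately have "T_decomposition scale I R.span"
    unfolding T_decomposition_def I_def by blast
  then show ?thesis
    by blast
qed

section \<open>Counting basis vectors modulo 2\<close>

definition projections ::
    "('r::comm_ring_1 \<Rightarrow> 'm::ab_group_add \<Rightarrow> 'm) \<Rightarrow> 'i set \<Rightarrow> ('i \<Rightarrow> 'm set) \<Rightarrow> ('i \<Rightarrow> 'm \<Rightarrow> 'm) \<Rightarrow> bool"
  where "projections scale I N p \<longleftrightarrow>
    (\<forall>i. module_hom scale scale (p i)) \<and> (\<forall>i\<in>I. \<forall>x. p i x \<in> N i) \<and>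
    (\<forall>i x. p i x \<noteq> 0 \<longrightarrow> i \<in> I) \<and> (\<forall>x. finite {i. p i x \<noteq> 0}) \<and>
    (\<forall>x. x = (\<Sum>i | p i x \<noteq> 0. p i x)) \<and>
    (\<forall>i\<in>I. \<forall>y\<in>N i. \<forall>j. p j y = (if j = i then y else 0))"

text \<open>
  The components of \<open>x + y\<close> and of \<open>r x\<close> can be read off from those of \<open>x\<close> and \<open>y\<close> because of
  the uniqueness of the family representing an element.
\<close>

lemma direct_sum_decomposition_projections:
  fixes N :: "'i \<Rightarrow> 'm::ab_group_add set"
  assumes "module scale" and dec: "direct_sum_decomposition scale I N"
  shows "\<exists>p. projections scale I N p"
proof -
  interpret module scale
    by fact
  have sub: "subspace (N i)" if "i \<in> I" for i
    using dec that by (auto simp: direct_sum_decomposition_def)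
  define family where "family x h \<longleftrightarrow> (\<forall>i\<in>I. h i \<in> N i) \<and> (\<forall>i. h i \<noteq> 0 \<longrightarrow> i \<in> I) \<and>
    finite {i. h i \<noteq> 0} \<and> x = (\<Sum>i | h i \<noteq> 0. h i)" for x h
  have family_iff: "family x (lookup f) \<longleftrightarrow>
      keys f \<subseteq> I \<and> (\<forall>i\<in>I. lookup f i \<in> N i) \<and> x = (\<Sum>i\<in>keys f. lookup f i)" for x f
    by (auto simp: family_def keys.rep_eq)
  have "\<exists>f. family x (lookup f)" for x
    using dec unfolding direct_sum_decomposition_def family_iff by blast
  then obtain f where f: "\<And>x. family x (lookup (f x))"
    by metis
  have unique: "h = lookup (f x)" if "family x h" for x h
  proof -
    have h: "lookup (Abs_poly_mapping h) = h"
      using that by (intro lookup_Abs_poly_mapping) (simp add: family_def)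
    have "Abs_poly_mapping h = f x"
      using dec that f[of x] unfolding direct_sum_decomposition_def
      by (metis family_iff h)
    then show ?thesis
      using h by simp
  qed
  define p where "p i x = lookup (f x) i" for i x
  have p: "family x (\<lambda>i. p i x)" for x
    using f by (simp add: p_def)
  have p_I: "i \<in> I" if "p i x \<noteq> 0" for i x
    using that p[of x] by (simp add: family_def)
  have p_eq: "p i x = h i" if "family x h" for i x h
    using unique[OF that] by (simp add: p_def)
  have sum_eq: "(\<Sum>i | h i \<noteq> 0. h i) = sum h T" if "finite T" "{i. h i \<noteq> 0} \<subseteq> T" for h :: "'i \<Rightarrow> 'm" and T
    using that by (intro sum.mono_neutral_left) auto
  have add: "p i (x + y) = p i x + p i y" for i x y
  proof (rule p_eq)
    let ?T = "{i. p i x \<noteq> 0} \<union> {i. p i y \<noteq> 0}"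
    have T: "finite ?T"
      using p by (simp add: family_def)
    have "x = (\<Sum>i\<in>?T. p i x)" "y = (\<Sum>i\<in>?T. p i y)"
      using sum_eq[OF T, of "\<lambda>i. p i x"] sum_eq[OF T, of "\<lambda>i. p i y"] p[of x] p[of y]
      by (auto simp: family_def)
    moreover have "(\<Sum>i | p i x + p i y \<noteq> 0. p i x + p i y) = (\<Sum>i\<in>?T. p i x + p i y)"
      by (rule sum_eq[OF T]) auto
    ultimately have "x + y = (\<Sum>i | p i x + p i y \<noteq> 0. p i x + p i y)"
      by (simp add: sum.distrib)
    moreover have "finite {i. p i x + p i y \<noteq> 0}"
      using T by (rule rev_finite_subset) auto
    moreover have "i \<in> I" if "p i x + p i y \<noteq> 0" for i
      using that p_I[of i x] p_I[of i y] by (cases "p i x = 0") auto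
    ultimately show "family (x + y) (\<lambda>i. p i x + p i y)"
      using p[of x] p[of y] sub by (simp add: family_def subspace_add)
  qed
  have scale: "p i (scale r x) = scale r (p i x)" for i r x
  proof (rule p_eq)
    let ?T = "{i. p i x \<noteq> 0}"
    have T: "finite ?T"
      using p by (simp add: family_def)
    have "(\<Sum>i | scale r (p i x) \<noteq> 0. scale r (p i x)) = (\<Sum>i\<in>?T. scale r (p i x))"
      by (rule sum_eq[OF T]) auto
    also have "\<dots> = scale r x"
      using p[of x] by (simp add: family_def flip: scale_sum_right)
    finally have "scale r x = (\<Sum>i | scale r (p i x) \<noteq> 0. scale r (p i x))" ..
    moreover have "finite {i. scale r (p i x) \<noteq> 0}"
      using T by (rule rev_finite_subset) auto
    moreover have "i \<in> I" if "scale r (p i x) \<noteq> 0" for i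
      using that p_I[of i x] by (cases "p i x = 0") auto
    ultimately show "family (scale r x) (\<lambda>i. scale r (p i x))"
      using p[of x] sub by (simp add: family_def subspace_scale)
  qed
  have on_summand: "p j y = (if j = i then y else 0)" if i: "i \<in> I" "y \<in> N i" for i j y
  proof (rule p_eq)
    have "{j. (if j = i then y else 0) \<noteq> 0} = (if y = 0 then {} else {i})"
      by auto
    then show "family y (\<lambda>j. if j = i then y else 0)"
      using i sub by (auto simp: family_def subspace_0)
  qed
  have "module_hom scale scale (p i)" for i
    using assms(1) add scale by (simp add: module_hom_iff)
  then have "projections scale I N p"
    using p on_summand unfolding projections_def family_def by simp
  then show ?thesis
    by blast
qed

lemma finite_Fpow_iff: "finite (Fpow A) \<longleftrightarrow> finite A"
proof
  assume "finite (Fpow A)"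
  moreover have "(\<lambda>a. {a}) ` A \<subseteq> Fpow A"
    by (auto simp: Fpow_def)
  ultimately have "finite ((\<lambda>a. {a}) ` A)"
    by (rule rev_finite_subset)
  then show "finite A"
    by (rule finite_imageD) auto
next
  assume "finite A"
  then show "finite (Fpow A)"
    by (intro finite_subset[OF Fpow_subset_Pow]) simp
qed

text \<open>
  When \<open>L / H\<close> is a vector space over the field with two elements, the classes of the \<open>b i\<close> form
  a basis of it: every vector is the sum over a unique finite set of basis vectors, as the only
  coefficients are 0 and 1.
\<close>

definition mod_2_basis :: "'m::ab_group_add set \<Rightarrow> 'm set \<Rightarrow> 'i set \<Rightarrow> ('i \<Rightarrow> 'm) \<Rightarrow> bool"
  where "mod_2_basis L H I b \<longleftrightarrow> b ` I \<subseteq> L \<and> (\<forall>x\<in>L. \<exists>!S. S \<in> Fpow I \<and> x - sum b S \<in> H)"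

text \<open>
  Both collections of finite subsets are in bijection with \<open>L / H\<close>. For infinite index sets the
  finite subsets are as numerous as the elements, and for finite ones \<open>2 ^ m = 2 ^ n\<close> implies
  \<open>m = n\<close>.
\<close>

lemma mod_2_basis_eqpoll:
  assumes "module scale" and L: "module.subspace scale L" and H: "module.subspace scale H"
    and b: "mod_2_basis L H I b" and c: "mod_2_basis L H J c"
  shows "I \<approx> J"
proof -
  interpret module scale
    by fact
  have b_ex1: "\<exists>!S. S \<in> Fpow I \<and> x - sum b S \<in> H" if "x \<in> L" for x
    using b that by (simp add: mod_2_basis_def)
  have c_ex1: "\<exists>!T. T \<in> Fpow J \<and> x - sum c T \<in> H" if "x \<in> L" for x
    using c that by (simp add: mod_2_basis_def)
  have in_L: "sum b S \<in> L" if "S \<in> Fpow I" for S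
    using that b L by (auto simp: mod_2_basis_def Fpow_def intro!: subspace_sum)
  have in_L': "sum c T \<in> L" if "T \<in> Fpow J" for T
    using that c L by (auto simp: mod_2_basis_def Fpow_def intro!: subspace_sum)
  define f where "f S = (THE T. T \<in> Fpow J \<and> sum b S - sum c T \<in> H)" for S
  have f: "f S \<in> Fpow J \<and> sum b S - sum c (f S) \<in> H" if "S \<in> Fpow I" for S
    unfolding f_def using c_ex1[OF in_L[OF that]] by (rule theI')
  have f_eq: "f S = T" if "S \<in> Fpow I" "T \<in> Fpow J" "sum b S - sum c T \<in> H" for S T
    unfolding f_def using c_ex1[OF in_L[OF that(1)]] that(2,3) by (intro the1_equality) auto
  have sym: "x - y \<in> H \<longleftrightarrow> y - x \<in> H" for x y
    using subspace_neg[OF H] by (metis minus_diff_eq)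
  have "bij_betw f (Fpow I) (Fpow J)"
  proof (rule bij_betw_imageI)
    show "inj_on f (Fpow I)"
    proof (rule inj_onI)
      fix S S'
      assume S: "S \<in> Fpow I" "S' \<in> Fpow I" "f S = f S'"
      then have "sum c (f S) - sum b S \<in> H" "sum c (f S) - sum b S' \<in> H"
        using f[of S] f[of S'] sym by auto
      then show "S = S'"
        using b_ex1[OF in_L'[of "f S"]] S f[of S] by blast
    qed
    show "f ` Fpow I = Fpow J"
    proof (rule subset_antisym)
      show "Fpow J \<subseteq> f ` Fpow I"
      proof
        fix T
        assume T: "T \<in> Fpow J"
        then obtain S where "S \<in> Fpow I" "sum c T - sum b S \<in> H"
          using b_ex1[OF in_L'[OF T]] by blast
        then show "T \<in> f ` Fpow I"
          using f_eq[of S T] T sym by (metis imageI)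
      qed
    qed (use f in blast)
  qed
  then have Fpow: "Fpow I \<approx> Fpow J"
    by (auto simp: eqpoll_def)
  show ?thesis
  proof (cases "finite I")
    case True
    then have fin: "finite J"
      using eqpoll_finite_iff[OF Fpow] by (simp add: finite_Fpow_iff)
    then have "Fpow I = Pow I" "Fpow J = Pow J"
      using True by (auto simp: Fpow_def intro: finite_subset)
    then have "card (Pow I) = card (Pow J)"
      using Fpow True fin by (simp add: eqpoll_iff_card)
    then show ?thesis
      using True fin by (simp add: card_Pow eqpoll_iff_card)
  next
    case False
    then have "infinite J"
      using eqpoll_finite_iff[OF Fpow] by (simp add: finite_Fpow_iff)
    have "I \<approx> Fpow I"
      using eqpoll_Fpow[OF False] by (rule eqpoll_sym)
    also note Fpow
    also have "Fpow J \<approx> J"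
      using \<open>infinite J\<close> by (rule eqpoll_Fpow)
    finally show ?thesis .
  qed
qed

text \<open>
  A direct summand \<open>N\<close> is considered together with a projection onto it, because membership of
  an element of \<open>N\<close> in \<open>(1 + s) M\<close> or in \<open>ker (1 - s) + ker (1 + s)\<close> is witnessed by elements of
  \<open>M\<close>, which have to be projected back to \<open>N\<close>.
\<close>

definition retract :: "('r::comm_ring_1 \<Rightarrow> 'm::ab_group_add \<Rightarrow> 'm) \<Rightarrow> 'm set \<Rightarrow> bool"
  where "retract scale N \<longleftrightarrow>
    (\<exists>p. module_hom scale scale p \<and> (\<forall>x. p x \<in> N) \<and> (\<forall>y\<in>N. p y = y))"

lemma direct_summand_retract:
  assumes "module scale" "direct_sum_decomposition scale I N" "i \<in> I"
  shows "retract scale (N i)"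
proof -
  obtain p where "projections scale I N p"
    using direct_sum_decomposition_projections[OF assms(1,2)] by blast
  then show ?thesis
    using assms(3) unfolding retract_def projections_def by (intro exI[of _ "p i"]) simp
qed

text \<open>
  The summand contributes exactly one dimension to \<open>L / H\<close>.
\<close>

definition order_2_class :: "'m::ab_group_add set \<Rightarrow> 'm set \<Rightarrow> 'm set \<Rightarrow> bool"
  where "order_2_class L H N \<longleftrightarrow> (\<exists>b\<in>N \<inter> L. b \<notin> H \<and> (\<forall>x\<in>N \<inter> L. x \<in> H \<or> x - b \<in> H))"

text \<open>
  Invariance under endomorphisms, applied to the projections, makes \<open>L / H\<close> the direct sum of
  the contributions of the summands. The finite set belonging to \<open>x\<close> consists of the \<open>i\<close> for
  which the component of \<open>x\<close> is not in \<open>H\<close>.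
\<close>

lemma direct_sum_mod_2_basis:
  fixes N :: "'i \<Rightarrow> 'm::ab_group_add set"
  assumes "module scale" and dec: "direct_sum_decomposition scale I N" and "K \<subseteq> I"
    and L: "module.subspace scale L" and H: "module.subspace scale H"
    and L_invariant: "\<And>g x. module_hom scale scale g \<Longrightarrow> x \<in> L \<Longrightarrow> g x \<in> L"
    and H_invariant: "\<And>g x. module_hom scale scale g \<Longrightarrow> x \<in> H \<Longrightarrow> g x \<in> H"
    and K: "\<And>i. i \<in> K \<Longrightarrow> order_2_class L H (N i)"
    and not_K: "\<And>i. i \<in> I \<Longrightarrow> i \<notin> K \<Longrightarrow> N i \<inter> L \<subseteq> H"
  shows "\<exists>b. mod_2_basis L H K b"
proof -
  interpret module scale
    by fact
  obtain p where p: "projections scale I N p"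
    using direct_sum_decomposition_projections[OF assms(1,2)] by blast
  have hom: "module_hom scale scale (p i)" and fin: "finite {i. p i x \<noteq> 0}" for i x
    using p by (simp_all add: projections_def)
  have p_I: "i \<in> I" if "p i x \<noteq> 0" for i x
    using p that unfolding projections_def by blast
  have p_N: "p i x \<in> N i" and p_eq: "y \<in> N i \<Longrightarrow> p j y = (if j = i then y else 0)" if "i \<in> I" for i j x y
    using p that by (simp_all add: projections_def)
  have x_eq: "x = (\<Sum>i | p i x \<noteq> 0. p i x)" for x
    using p unfolding projections_def by blast
  have "\<exists>b. b \<in> N i \<inter> L \<and> b \<notin> H \<and> (\<forall>x\<in>N i \<inter> L. x \<in> H \<or> x - b \<in> H)" if "i \<in> K" for i
    using K[OF that] by (auto simp: order_2_class_def)
  then obtain b where b: "\<And>i. i \<in> K \<Longrightarrow> b i \<in> N i" "\<And>i. i \<in> K \<Longrightarrow> b i \<in> L" "\<And>i. i \<in> K \<Longrightarrow> b i \<notin> H"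
    and b_class: "\<And>i x. i \<in> K \<Longrightarrow> x \<in> N i \<Longrightarrow> x \<in> L \<Longrightarrow> x \<in> H \<or> x - b i \<in> H"
    by (metis IntI IntD1 IntD2)
  have diff_b: "p i (x - sum b S) = p i x - (if i \<in> S then b i else 0)" if S: "S \<in> Fpow K" for i x S
  proof -
    have "p i (b j) = (if i = j then b j else 0)" if "j \<in> S" for j
    proof -
      have "j \<in> K" "j \<in> I"
        using that S \<open>K \<subseteq> I\<close> by (auto simp: Fpow_def)
      then show ?thesis
        using p_eq[of j "b j" i] b(1) by simp
    qed
    moreover have "p i (sum b S) = (\<Sum>j\<in>S. p i (b j))"
      by (rule module_hom.sum[OF hom])
    moreover have "(\<Sum>j\<in>S. if i = j then b j else 0) = (if i \<in> S then b i else 0)"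
      using S by (simp add: Fpow_def)
    ultimately show ?thesis
      by (simp add: module_hom.diff[OF hom])
  qed
  have "\<exists>!S. S \<in> Fpow K \<and> x - sum b S \<in> H" if x: "x \<in> L" for x
  proof
    define S where "S = {i\<in>K. p i x \<notin> H}"
    have "S \<subseteq> {i. p i x \<noteq> 0}"
      using subspace_0[OF H] by (auto simp: S_def)
    then have S: "S \<in> Fpow K"
      using fin[of x] finite_subset by (auto simp: S_def Fpow_def)
    have "p i (x - sum b S) \<in> H" for i
    proof (cases "i \<in> I")
      case True
      have "p i x \<in> L" "p i x \<in> N i"
        using L_invariant[OF hom x] p_N True by auto
      then show ?thesis
        using b_class[of i "p i x"] not_K[of i] True unfolding diff_b[OF S] by (auto simp: S_def)
    next
      case False
      then show ?thesis
        using p_I subspace_0[OF H] by metis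
    qed
    then have "x - sum b S \<in> H"
      by (subst x_eq) (rule subspace_sum[OF H])
    then show "S \<in> Fpow K \<and> x - sum b S \<in> H"
      using S by blast
    fix S'
    assume S': "S' \<in> Fpow K \<and> x - sum b S' \<in> H"
    have iff: "i \<in> S' \<longleftrightarrow> p i x \<notin> H" if "i \<in> K" for i
    proof -
      have *: "p i x - (if i \<in> S' then b i else 0) \<in> H"
        using H_invariant[OF hom, of "x - sum b S'" i] S' by (simp add: diff_b)
      show ?thesis
        using * b(3)[OF that] subspace_diff[OF H, of "p i x" "p i x - b i"] by (auto split: if_splits)
    qed
    then show "S' = S"
      using S' by (auto simp: S_def Fpow_def)
  qed
  then show ?thesis
    using b(2) unfolding mod_2_basis_def by (intro exI[of _ b]) auto
qed

section \<open>The invariants that determine the multiplicities\<close>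

context group_ring_module
begin

text \<open>
  With \<open>e = sigma\<close> and \<open>e = - sigma\<close>, the quotients of \<open>fixed e\<close> by \<open>traces e\<close> are the
  invariants that count \<open>T1\<close> and \<open>T2\<close>. They are the Tate cohomology groups of the group of order
  2 with coefficients in the module.
\<close>

definition fixed :: "group_ring_Z2 \<Rightarrow> 'm set"
  where "fixed e = {x. scale e x = x}"

definition traces :: "group_ring_Z2 \<Rightarrow> 'm set"
  where "traces e = range (\<lambda>x. x + scale e x)"

definition eigensums :: "'m set"
  where "eigensums = {x + y | x y. x \<in> fixed sigma \<and> y \<in> fixed (- sigma)}"

text \<open>
  The isomorphism types are described by additive coordinates and the effect of \<open>e\<close> on them, so
  that replacing \<open>e\<close> by \<open>- e\<close> exchanges \<open>T1\<close> with \<open>T2\<close> and preserves \<open>T3\<close>.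
\<close>

definition line :: "group_ring_Z2 \<Rightarrow> 'm set \<Rightarrow> bool"
  where "line e N \<longleftrightarrow> (\<exists>f. additive f \<and> inj f \<and> range f = N \<and> (\<forall>n :: int. scale e (f n) = f n))"

definition swap_plane :: "group_ring_Z2 \<Rightarrow> 'm set \<Rightarrow> bool"
  where "swap_plane e N \<longleftrightarrow> (\<exists>f :: int \<Rightarrow> int \<Rightarrow> 'm.
    (\<forall>a b c d. f (a + c) (b + d) = f a b + f c d) \<and> (\<forall>a b. f a b = 0 \<longrightarrow> a = 0 \<and> b = 0) \<and>
    N = {f a b | a b. True} \<and> (\<forall>a b. scale e (f a b) = f b a))"

lemma subspace_fixed: "subspace (fixed e)"
proof (rule subspaceI)
  fix x c
  assume "x \<in> fixed e"
  then show "scale c x \<in> fixed e"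
    using scale_left_commute[of e c x] by (simp add: fixed_def)
qed (auto simp: fixed_def scale_right_distrib)

lemma subspace_traces: "subspace (traces e)"
proof (rule subspaceI)
  show "0 \<in> traces e"
    unfolding traces_def by (rule range_eqI[of _ _ 0]) simp
  fix x y c
  assume "x \<in> traces e"
  then obtain u where u: "x = u + scale e u"
    by (auto simp: traces_def)
  show "scale c x \<in> traces e"
    unfolding traces_def u
    by (rule range_eqI[of _ _ "scale c u"]) (simp add: scale_right_distrib mult.commute)
  assume "y \<in> traces e"
  then obtain v where v: "y = v + scale e v"
    by (auto simp: traces_def)
  show "x + y \<in> traces e"
    unfolding traces_def u v by (rule range_eqI[of _ _ "u + v"]) (simp add: scale_right_distrib)
qed

lemma subspace_eigensums: "subspace eigensums"
proof (rule subspaceI)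
  show "0 \<in> eigensums"
    using subspace_0[OF subspace_fixed] unfolding eigensums_def by force
  fix x y c
  assume "x \<in> eigensums"
  then obtain a b where x: "x = a + b" "a \<in> fixed sigma" "b \<in> fixed (- sigma)"
    by (auto simp: eigensums_def)
  have "scale c x = scale c a + scale c b"
    by (simp add: x scale_right_distrib)
  then show "scale c x \<in> eigensums"
    using x subspace_scale[OF subspace_fixed] unfolding eigensums_def by blast
  assume "y \<in> eigensums"
  then obtain a' b' where y: "y = a' + b'" "a' \<in> fixed sigma" "b' \<in> fixed (- sigma)"
    by (auto simp: eigensums_def)
  have "x + y = (a + a') + (b + b')"
    by (simp add: x y)
  then show "x + y \<in> eigensums"
    using x y subspace_add[OF subspace_fixed] unfolding eigensums_def by blast
qed

lemma fixed_invariant: "module_hom scale scale g \<Longrightarrow> x \<in> fixed e \<Longrightarrow> g x \<in> fixed e"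
  unfolding fixed_def module_hom_iff by (metis (mono_tags) mem_Collect_eq)

lemma traces_invariant: "module_hom scale scale g \<Longrightarrow> x \<in> traces e \<Longrightarrow> g x \<in> traces e"
  by (auto simp: traces_def module_hom_iff)

lemma eigensums_invariant:
  assumes g: "module_hom scale scale g" and "x \<in> eigensums"
  shows "g x \<in> eigensums"
proof -
  obtain a b where x: "x = a + b" "a \<in> fixed sigma" "b \<in> fixed (- sigma)"
    using assms(2) by (auto simp: eigensums_def)
  have "g x = g a + g b"
    using g by (simp add: module_hom_iff x)
  then show ?thesis
    using fixed_invariant[OF g] x unfolding eigensums_def by blast
qed

lemma T1_line:
  assumes "submodule_iso scale N T1"
  shows "line sigma N"
proof -
  obtain f where f: "module_hom T1 scale f" "bij_betw f UNIV N"
    using assms by (auto simp: submodule_iso_def)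
  have "scale sigma (f n) = f n" for n
    using module_hom.scale[OF f(1), of sigma n] by (simp add: T1_sigma)
  then show ?thesis
    using f unfolding line_def additive_def module_hom_iff bij_betw_def by blast
qed

lemma T2_line:
  assumes "submodule_iso scale N T2"
  shows "line (- sigma) N"
proof -
  obtain f where f: "module_hom T2 scale f" "bij_betw f UNIV N"
    using assms by (auto simp: submodule_iso_def)
  have "s (f n) = - f n" for n
    using module_hom.scale[OF f(1), of sigma n] module_hom.neg[OF f(1), of n] by (simp add: T2_sigma)
  then have "scale (- sigma) (f n) = f n" for n
    by simp
  then show ?thesis
    using f unfolding line_def additive_def module_hom_iff bij_betw_def by blast
qed

lemma T3_swap_plane:
  assumes "submodule_iso scale N T3"
  shows "swap_plane sigma N"
proof -
  obtain h where h: "module_hom T3 scale h" "bij_betw h UNIV N"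
    using assms by (auto simp: submodule_iso_def)
  define r :: "int \<Rightarrow> int \<Rightarrow> group_ring_Z2" where "r a b = of_int a + of_int b * sigma" for a b
  have lookup_r: "lookup (r a b) 0 = a" "lookup (r a b) 1 = b" for a b
    by (auto simp: r_def sigma_def lookup_add mult_single lookup_single when_def simp flip: single_of_int)
  have "r (a + c) (b + d) = r a b + r c d" for a b c d
    by (simp add: r_def algebra_simps)
  moreover have "sigma * r a b = r b a" for a b
  proof -
    have "sigma * (of_int b * sigma) = of_int b"
      by (simp add: mult.left_commute[of sigma "of_int b"] sigma_sigma)
    then show ?thesis
      by (simp add: r_def distrib_left add.commute mult.commute[of sigma "of_int a"])
  qed
  moreover have "h (r a b) = 0 \<longrightarrow> a = 0 \<and> b = 0" for a b
  proof
    assume "h (r a b) = 0"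
    then have "r a b = 0"
      using h(2) module_hom.zero[OF h(1)] unfolding bij_betw_def inj_def by metis
    then show "a = 0 \<and> b = 0"
      using lookup_r by (metis lookup_zero)
  qed
  moreover have "N = {h (r a b) | a b. True}"
  proof -
    have "N = range h"
      using h(2) by (simp add: bij_betw_def)
    also have "\<dots> = {h (r a b) | a b. True}"
      using group_ring_Z2_eq by (auto simp: r_def) metis
    finally show ?thesis .
  qed
  ultimately show ?thesis
    using h(1) unfolding swap_plane_def module_hom_iff T3_def
    by (intro exI[of _ "\<lambda>a b. h (r a b)"]) metis
qed

text \<open>
  Changing the sign of the second basis vector turns a swap into a negated swap.
\<close>

lemma swap_plane_neg:
  assumes "swap_plane e N"
  shows "swap_plane (- e) N"
proof -
  obtain f :: "int \<Rightarrow> int \<Rightarrow> 'm" where add: "\<And>a b c d. f (a + c) (b + d) = f a b + f c d"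
    and inj: "\<And>a b. f a b = 0 \<Longrightarrow> a = 0 \<and> b = 0" and N: "N = {f a b | a b. True}"
    and swap: "\<And>a b. scale e (f a b) = f b a"
    using assms unfolding swap_plane_def by blast
  have "f 0 0 = 0"
    using add[of 0 0 0 0] by simp
  then have neg: "- f a b = f (- a) (- b)" for a b
    using add[of a "- a" b "- b"] by (simp add: neg_eq_iff_add_eq_0)
  have "f a b \<in> {f a (- b) | a b. True}" for a b
    by (rule CollectI) (metis minus_minus)
  then have "N = {f a (- b) | a b. True}"
    unfolding N by blast
  moreover have "scale (- e) (f a (- b)) = f b (- a)" for a b
    by (simp add: swap neg)
  moreover have "f (a + c) (- (b + d)) = f a (- b) + f c (- d)" for a b c d
    by (simp flip: add)
  ultimately show ?thesis
    unfolding swap_plane_def using inj by (intro exI[of _ "\<lambda>a b. f a (- b)"]) force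
qed

text \<open>
  On a line \<open>e\<close> acts trivially, so its traces are the even multiples of a generator.
\<close>

lemma line_order_2_class:
  assumes "line e N" "retract scale N"
  shows "order_2_class (fixed e) (traces e) N"
proof -
  obtain f :: "int \<Rightarrow> 'm" where f: "additive f" "inj f" "range f = N" "\<And>n. scale e (f n) = f n"
    using assms(1) unfolding line_def by blast
  obtain p where p: "module_hom scale scale p" "\<And>x. p x \<in> N" "\<And>y. y \<in> N \<Longrightarrow> p y = y"
    using assms(2) unfolding retract_def by blast
  have even: "f n \<in> traces e" if "even n" for n
  proof -
    have "f n = f (n div 2) + scale e (f (n div 2))"
      using that additive.add[OF f(1), of "n div 2" "n div 2"] f(4) by simp
    then show ?thesis
      by (auto simp: traces_def)
  qed
  have "f 1 \<notin> traces e"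
  proof
    assume "f 1 \<in> traces e"
    then obtain z where z: "f 1 = z + scale e z"
      by (auto simp: traces_def)
    obtain m where m: "p z = f m"
      using p(2)[of z] f(3) by auto
    have "f 1 \<in> N"
      using f(3) by blast
    then have "f 1 = p (f 1)"
      by (simp add: p(3))
    also have "\<dots> = f (m + m)"
      unfolding z using p(1) additive.add[OF f(1), of m m] by (simp add: module_hom_iff m f(4))
    finally have "1 = m + m"
      using f(2) by (simp add: inj_def)
    then show False
      by presburger
  qed
  moreover have "x \<in> traces e \<or> x - f 1 \<in> traces e" if "x \<in> N" for x
  proof -
    obtain n where n: "x = f n"
      using \<open>x \<in> N\<close> f(3) by auto
    have "x - f 1 = f (n - 1)"
      by (simp add: n additive.diff[OF f(1)])
    then show ?thesis
      using even[of n] even[of "n - 1"] by (cases "even n") (auto simp: n)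
  qed
  moreover have "f 1 \<in> N \<inter> fixed e"
    using f by (auto simp: fixed_def)
  ultimately show ?thesis
    unfolding order_2_class_def by blast
qed

lemma neg_line_fixed:
  assumes "line (- e) N"
  shows "N \<inter> fixed e \<subseteq> traces e"
proof
  fix x
  assume x: "x \<in> N \<inter> fixed e"
  obtain f :: "int \<Rightarrow> 'm" where f: "additive f" "inj f" "range f = N" "\<And>n. scale (- e) (f n) = f n"
    using assms unfolding line_def by blast
  obtain n where n: "x = f n"
    using x f(3) by auto
  have "f n = - f n"
    using x f(4)[of n] by (simp add: n fixed_def)
  then have "f n = f (- n)"
    by (simp add: additive.minus[OF f(1)])
  then have "n = - n"
    using f(2) by (rule injD[rotated])
  then have "n = 0"
    by simp
  then have "x = 0"
    by (simp add: n additive.zero[OF f(1)])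
  then show "x \<in> traces e"
    using subspace_0[OF subspace_traces] by simp
qed

lemma swap_plane_fixed:
  assumes "swap_plane e N"
  shows "N \<inter> fixed e \<subseteq> traces e"
proof
  fix x
  assume x: "x \<in> N \<inter> fixed e"
  obtain f :: "int \<Rightarrow> int \<Rightarrow> 'm" where add: "\<And>a b c d. f (a + c) (b + d) = f a b + f c d"
    and inj: "\<And>a b. f a b = 0 \<Longrightarrow> a = 0 \<and> b = 0" and N: "N = {f a b | a b. True}"
    and swap: "\<And>a b. scale e (f a b) = f b a"
    using assms unfolding swap_plane_def by blast
  obtain a b where ab: "x = f a b"
    using x N by blast
  have "f b a = f a b"
    using x swap[of a b] by (simp add: ab fixed_def)
  also have "f a b = f (a - b) (b - a) + f b a"
    by (simp flip: add)
  finally have "f (a - b) (b - a) = 0"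
    by (simp only: add_cancel_right_left)
  then have "a - b = 0"
    using inj by blast
  then have "a = b"
    by simp
  then have "x = f a 0 + scale e (f a 0)"
    by (simp add: swap ab flip: add)
  then show "x \<in> traces e"
    by (auto simp: traces_def)
qed

lemma fixed_subset_eigensums: "fixed sigma \<subseteq> eigensums" "fixed (- sigma) \<subseteq> eigensums"
  using subspace_0[OF subspace_fixed] unfolding eigensums_def by (force, force)

lemma line_eigensums: "line e N \<Longrightarrow> e = sigma \<or> e = - sigma \<Longrightarrow> N \<subseteq> eigensums"
  using fixed_subset_eigensums unfolding line_def by (auto simp: fixed_def)

text \<open>
  In the coordinates of a swapped plane, sums of a fixed and an anti-fixed vector have the form
  \<open>(m, m) + (n, - n)\<close>; these are the vectors whose coordinates have an even sum.
\<close>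

lemma swap_plane_order_2_class:
  assumes "swap_plane sigma N" "retract scale N"
  shows "order_2_class UNIV eigensums N"
proof -
  obtain f :: "int \<Rightarrow> int \<Rightarrow> 'm" where add: "\<And>a b c d. f (a + c) (b + d) = f a b + f c d"
    and inj: "\<And>a b. f a b = 0 \<Longrightarrow> a = 0 \<and> b = 0" and N: "N = {f a b | a b. True}"
    and swap: "\<And>a b. s (f a b) = f b a"
    using assms(1) unfolding swap_plane_def by blast
  obtain p where p: "module_hom scale scale p" "\<And>x. p x \<in> N" "\<And>y. y \<in> N \<Longrightarrow> p y = y"
    using assms(2) unfolding retract_def by blast
  have f0: "f 0 0 = 0"
    using add[of 0 0 0 0] by simp
  have neg: "- f a b = f (- a) (- b)" for a b
    using add[of a "- a" b "- b"] f0 by (simp add: neg_eq_iff_add_eq_0)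
  have f_eq: "a = c \<and> b = d" if "f a b = f c d" for a b c d
    using inj[of "a - c" "b - d"] add[of "a - c" c "b - d" d] that by simp
  have even: "f a b \<in> eigensums" if "even (a + b)" for a b
  proof -
    \<comment> \<open>Solving \<open>a = m + n\<close> and \<open>b = m - n\<close> needs an even sum of coordinates.\<close>
    define m n where "m = (a + b) div 2" and "n = (a - b) div 2"
    have "a = m + n" "b = m - n"
      using that unfolding m_def n_def by presburger+
    then have "f a b = f m m + f n (- n)"
      by (simp flip: add)
    moreover have "f m m \<in> fixed sigma" "f n (- n) \<in> fixed (- sigma)"
      by (simp_all add: fixed_def swap neg)
    ultimately show ?thesis
      unfolding eigensums_def by blast
  qed
  have "f 1 0 \<notin> eigensums"
  proof
    assume "f 1 0 \<in> eigensums"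
    then obtain x y where xy: "f 1 0 = x + y" "x \<in> fixed sigma" "y \<in> fixed (- sigma)"
      by (auto simp: eigensums_def)
    obtain a b where a: "p x = f a b"
      using p(2)[of x] N by blast
    obtain c d where c: "p y = f c d"
      using p(2)[of y] N by blast
    have "f b a = f a b"
      using fixed_invariant[OF p(1) xy(2)] by (simp add: a fixed_def swap)
    then have "a = b"
      using f_eq by blast
    have "f (- d) (- c) = f c d"
      using fixed_invariant[OF p(1) xy(3)] by (simp add: c fixed_def swap neg)
    then have "d = - c"
      using f_eq by force
    have "f 1 0 \<in> N"
      using N by blast
    then have "f 1 0 = p (f 1 0)"
      by (simp add: p(3))
    also have "\<dots> = f (a + c) (b + d)"
      unfolding xy(1) using p(1) by (simp add: module_hom_iff a c add)
    finally have "1 = a + c" "0 = b + d"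
      using f_eq by blast+
    then show False
      using \<open>a = b\<close> \<open>d = - c\<close> by presburger
  qed
  moreover have "x \<in> eigensums \<or> x - f 1 0 \<in> eigensums" if "x \<in> N" for x
  proof -
    obtain a b where x: "x = f a b"
      using \<open>x \<in> N\<close> N by blast
    have "x - f 1 0 = f (a - 1) b"
      using add[of "a - 1" 1 b 0] by (simp add: x)
    then show ?thesis
      using even[of a b] even[of "a - 1" b] by (cases "even (a + b)") (auto simp: x)
  qed
  moreover have "f 1 0 \<in> N"
    using N by blast
  ultimately show ?thesis
    unfolding order_2_class_def by blast
qed

lemma T1_summands_basis:
  assumes "T_decomposition scale I N"
  shows "\<exists>b. mod_2_basis (fixed sigma) (traces sigma) (summands_iso scale I N T1) b"
proof (rule direct_sum_mod_2_basis)
  show "direct_sum_decomposition scale I N"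
    using assms by (simp add: T_decomposition_def)
  show "order_2_class (fixed sigma) (traces sigma) (N i)" if "i \<in> summands_iso scale I N T1" for i
    using assms that direct_summand_retract[OF module_axioms]
    by (intro line_order_2_class T1_line) (auto simp: summands_iso_def T_decomposition_def)
  show "N i \<inter> fixed sigma \<subseteq> traces sigma" if "i \<in> I" "i \<notin> summands_iso scale I N T1" for i
    using assms that swap_plane_fixed[OF T3_swap_plane] neg_line_fixed[OF T2_line]
    unfolding T_decomposition_def summands_iso_def by blast
qed (use module_axioms subspace_fixed subspace_traces fixed_invariant traces_invariant
  in \<open>auto simp: summands_iso_def\<close>)

lemma T2_summands_basis:
  assumes "T_decomposition scale I N"
  shows "\<exists>b. mod_2_basis (fixed (- sigma)) (traces (- sigma)) (summands_iso scale I N T2) b"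
proof (rule direct_sum_mod_2_basis)
  show "direct_sum_decomposition scale I N"
    using assms by (simp add: T_decomposition_def)
  show "order_2_class (fixed (- sigma)) (traces (- sigma)) (N i)" if "i \<in> summands_iso scale I N T2" for i
    using assms that direct_summand_retract[OF module_axioms]
    by (intro line_order_2_class T2_line) (auto simp: summands_iso_def T_decomposition_def)
  show "N i \<inter> fixed (- sigma) \<subseteq> traces (- sigma)" if "i \<in> I" "i \<notin> summands_iso scale I N T2" for i
    using assms that swap_plane_fixed[OF swap_plane_neg[OF T3_swap_plane]]
      neg_line_fixed[of "- sigma"] T1_line
    unfolding T_decomposition_def summands_iso_def by auto
qed (use module_axioms subspace_fixed subspace_traces fixed_invariant traces_invariant
  in \<open>auto simp: summands_iso_def\<close>)

lemma T3_summands_basis: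
  assumes "T_decomposition scale I N"
  shows "\<exists>b. mod_2_basis UNIV eigensums (summands_iso scale I N T3) b"
proof (rule direct_sum_mod_2_basis)
  show "direct_sum_decomposition scale I N"
    using assms by (simp add: T_decomposition_def)
  show "order_2_class UNIV eigensums (N i)" if "i \<in> summands_iso scale I N T3" for i
    using assms that direct_summand_retract[OF module_axioms]
    by (intro swap_plane_order_2_class T3_swap_plane) (auto simp: summands_iso_def T_decomposition_def)
  show "N i \<inter> UNIV \<subseteq> eigensums" if "i \<in> I" "i \<notin> summands_iso scale I N T3" for i
  proof -
    have "submodule_iso scale (N i) T1 \<or> submodule_iso scale (N i) T2"
      using assms that by (auto simp: T_decomposition_def summands_iso_def)
    then have "N i \<subseteq> eigensums"
      using line_eigensums T1_line T2_line by blast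
    then show ?thesis
      by blast
  qed
qed (use module_axioms subspace_eigensums subspace_UNIV eigensums_invariant
  in \<open>auto simp: summands_iso_def\<close>)

end

theorem theorem2p8:
  fixes scale :: "group_ring_Z2 \<Rightarrow> 'm::ab_group_add \<Rightarrow> 'm"
  assumes "module scale"
    and "free_module (restrict_to_int scale)"
  shows "(\<exists>(I :: 'm set set) N. T_decomposition scale I N) \<and>
    (\<forall>(I :: 'i set) N (J :: 'j set) N'.
      T_decomposition scale I N \<longrightarrow> T_decomposition scale J N' \<longrightarrow>
        summands_iso scale I N T1 \<approx> summands_iso scale J N' T1 \<and>
        summands_iso scale I N T2 \<approx> summands_iso scale J N' T2 \<and>
        summands_iso scale I N T3 \<approx> summands_iso scale J N' T3)"
proof (intro conjI allI impI)
  interpret R: group_ring_module scale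
    using assms(1) by (rule group_ring_module.intro)
  show "\<exists>(I :: 'm set set) N. T_decomposition scale I N"
    using assms by (rule T_decomposition_exists)
  fix I :: "'i set" and J :: "'j set" and N N'
  assume "T_decomposition scale I N" "T_decomposition scale J N'"
  note dec = this
  show "summands_iso scale I N T1 \<approx> summands_iso scale J N' T1"
    using R.T1_summands_basis[OF dec(1)] R.T1_summands_basis[OF dec(2)]
      mod_2_basis_eqpoll[OF assms(1) R.subspace_fixed R.subspace_traces] by metis
  show "summands_iso scale I N T2 \<approx> summands_iso scale J N' T2"
    using R.T2_summands_basis[OF dec(1)] R.T2_summands_basis[OF dec(2)]
      mod_2_basis_eqpoll[OF assms(1) R.subspace_fixed R.subspace_traces] by metis
  show "summands_iso scale I N T3 \<approx> summands_iso scale J N' T3"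
    using R.T3_summands_basis[OF dec(1)] R.T3_summands_basis[OF dec(2)]
      mod_2_basis_eqpoll[OF assms(1) R.subspace_UNIV R.subspace_eigensums] by metis
qed

end
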